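(* Let $H$ be the hinge, and for $\lambda>0$ consider the activity vector $(\lambda_1,\lambda_2,\lambda_3)=(\lambda,1,\lambda)$ on $H$ (the Widom–Rowlinson model with activity $\lambda$). There exist real numbers $0<a<b<c$ and an infinite, countable, locally finite board $G$ such that $\hom(G,H)$ has a unique Gibbs measure for $(\lambda,1,\lambda)$ whenever $\lambda\in(0,a]\cup[b,c]$, and has more than one Gibbs measure for $(\lambda,1,\lambda)$ whenever $\lambda\in(a,b)\cup(c,\infty)$.
   Context: The hinge is the constraint graph with nodes $1$ (green), $2$ (yellow), $3$ (red), each node looped, and edges $\{1,2\},\{2,3\}$ (no edge between $1$ and $3$). $\hom(G,H)$ is the set of graph homomorphisms from the board $G$ (a countable locally finite loopless graph whose vertices are sites) to $H$, i.e. colorings of the sites by green, yellow, red with no green site adjacent to a red site, equipped with the product $\sigma$-algebra. For an activity vector $\mu=(\mu_1,\mu_2,\mu_3)$ with positive entries and a finite board, the $\mu$-measure gives $\varphi$ probability proportional to $\prod_v\mu_{\varphi(v)}$. A patch is a finite set $U$ of sites, $\partial U$ the set of sites outside $U$ adjacent to $U$, $U^+=U\cup\partial U$. A probability measure on $\hom(G,H)$ is a Gibbs measure for $\mu$ if for every patch $U$ and almost every $\psi$, its conditional probability that $\varphi|_U=\psi|_U$ given $\varphi|_{G\setminus U}=\psi|_{G\setminus U}$ equals the $\mu$-measure (on $\hom(U^+,H)$) conditional probability that $\varphi|_U=\psi|_U$ given $\varphi|_{\partial U}=\psi|_{\partial U}$. *)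

theory Defs
  imports "HOL-Probability.Probability"
begin

text \<open>Vertices of the hinge H: green (1), yellow (2), red (3).\<close>
datatype color = Green | Yellow | Red

definition hinge_adj :: "color \<Rightarrow> color \<Rightarrow> bool" where
  "hinge_adj c d \<longleftrightarrow> \<not> ((c = Green \<and> d = Red) \<or> (c = Red \<and> d = Green))"

definition board :: "(nat \<Rightarrow> nat \<Rightarrow> bool) \<Rightarrow> bool" where
  "board E \<longleftrightarrow> (\<forall>v w. E v w \<longrightarrow> E w v) \<and> (\<forall>v. \<not> E v v) \<and> (\<forall>v. finite {w. E v w})"

definition homs :: "(nat \<Rightarrow> nat \<Rightarrow> bool) \<Rightarrow> (nat \<Rightarrow> color) set" where
  "homs E = {\<phi>. \<forall>v w. E v w \<longrightarrow> hinge_adj (\<phi> v) (\<phi> w)}"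

definition config_space :: "(nat \<Rightarrow> nat \<Rightarrow> bool) \<Rightarrow> (nat \<Rightarrow> color) measure" where
  "config_space E = restrict_space (PiM UNIV (\<lambda>_. count_space UNIV)) (homs E)"

definition outside_algebra :: "(nat \<Rightarrow> nat \<Rightarrow> bool) \<Rightarrow> nat set \<Rightarrow> (nat \<Rightarrow> color) measure" where
  "outside_algebra E U = sigma (space (config_space E))
     {{\<phi> \<in> space (config_space E). \<phi> v \<in> A} | v A. v \<notin> U}"

definition bdry :: "(nat \<Rightarrow> nat \<Rightarrow> bool) \<Rightarrow> nat set \<Rightarrow> nat set" where
  "bdry E U = {w. w \<notin> U \<and> (\<exists>u\<in>U. E u w)}"

definition plus :: "(nat \<Rightarrow> nat \<Rightarrow> bool) \<Rightarrow> nat set \<Rightarrow> nat set" where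
  "plus E U = U \<union> bdry E U"

definition fin_homs :: "(nat \<Rightarrow> nat \<Rightarrow> bool) \<Rightarrow> nat set \<Rightarrow> (nat \<Rightarrow> color) set" where
  "fin_homs E W = {\<phi> \<in> PiE W (\<lambda>_. UNIV). \<forall>v\<in>W. \<forall>w\<in>W. E v w \<longrightarrow> hinge_adj (\<phi> v) (\<phi> w)}"

definition weight :: "(color \<Rightarrow> real) \<Rightarrow> nat set \<Rightarrow> (nat \<Rightarrow> color) \<Rightarrow> real" where
  "weight \<mu> W \<phi> = (\<Prod>v\<in>W. \<mu> (\<phi> v))"

definition mu_prob :: "(nat \<Rightarrow> nat \<Rightarrow> bool) \<Rightarrow> (color \<Rightarrow> real) \<Rightarrow> nat set \<Rightarrow> (nat \<Rightarrow> color) set \<Rightarrow> real" where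
  "mu_prob E \<mu> W S = (\<Sum>\<phi>\<in>S \<inter> fin_homs E W. weight \<mu> W \<phi>) / (\<Sum>\<phi>\<in>fin_homs E W. weight \<mu> W \<phi>)"

definition spec_prob :: "(nat \<Rightarrow> nat \<Rightarrow> bool) \<Rightarrow> (color \<Rightarrow> real) \<Rightarrow> nat set \<Rightarrow> (nat \<Rightarrow> color) \<Rightarrow> real" where
  "spec_prob E \<mu> U \<psi> =
     (let W = plus E U;
          A = {\<phi>. \<forall>v\<in>U. \<phi> v = \<psi> v};
          B = {\<phi>. \<forall>v\<in>bdry E U. \<phi> v = \<psi> v}
      in mu_prob E \<mu> W (A \<inter> B) / mu_prob E \<mu> W B)"

definition gibbs :: "(nat \<Rightarrow> nat \<Rightarrow> bool) \<Rightarrow> (color \<Rightarrow> real) \<Rightarrow> (nat \<Rightarrow> color) measure \<Rightarrow> bool" where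
  "gibbs E \<mu> P \<longleftrightarrow> prob_space P \<and> sets P = sets (config_space E) \<and>
     (\<forall>U. finite U \<longrightarrow>
        (AE \<psi> in P. real_cond_exp P (outside_algebra E U)
            (indicator {\<phi> \<in> space P. \<forall>v\<in>U. \<phi> v = \<psi> v}) \<psi> = spec_prob E \<mu> U \<psi>))"

definition wr :: "real \<Rightarrow> color \<Rightarrow> real" where
  "wr l c = (case c of Green \<Rightarrow> l | Yellow \<Rightarrow> 1 | Red \<Rightarrow> l)"

end

theory Submission
  imports Defs
begin

text \<open>
  The board is an infinite rooted tree in which every inner vertex has 60 inner children and 8
  pendant neighbours. Integrating out the pendant vertices turns the activity \<open>l\<close> into the
  effective activity \<open>l ((1 + l) / (1 + 2 l))\<^sup>8\<close> on the \<open>60\<close>-ary tree, which increases, decreases and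
  then increases again as a function of \<open>l\<close>.

  On the \<open>r\<close>-ary tree with activity \<open>L\<close> the ratios \<open>u\<close> (green to yellow) and \<open>v\<close> (red to yellow) of a
  subtree satisfy \<open>u = L ((1 + u) / (1 + u + v))\<^sup>r\<close> and its mirror image at a fixed point. A solution
  with \<open>u \<noteq> v\<close> yields two distinct tree-indexed Markov chains, which are Gibbs measures; if the only
  solution has \<open>u = v\<close>, monotonicity of the recursion squeezes the ratios under any boundary condition
  to this value, so all cylinder probabilities are determined. For \<open>u < v\<close> and
  \<open>w = (1 + v) / (1 + u)\<close>, writing \<open>S\<^sub>k = 1 + w + \<dots> + w\<^sup>k\<^sup>-\<^sup>1\<close>, one can solve for
  \<open>L = (S\<^sub>r\<^sub>+\<^sub>1 / S\<^sub>r)\<^sup>r / (w S\<^sub>r\<^sub>-\<^sub>1)\<close>. Log-convexity of \<open>k \<mapsto> S\<^sub>k / k\<close> shows that this exceeds its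
  value at \<open>w = 1\<close>, which is therefore the exact threshold, with uniqueness at the threshold itself.
\<close>

section \<open>Cylinders and local specifications\<close>

text \<open>Pendant vertices are what breaks monotonicity in the activity. A yellow vertex leaves
  its pendant neighbour three colors, a green or red one only two, so each pendant multiplies the
  activity by (1 + l) / (1 + 2 l), a factor falling from 1 towards 1/2. With k pendants the
  derivative of the effective activity has the sign of 2 l^2 + (3 - k) l + 1, which has two positive
  roots exactly when k \<ge> 6; for large l the factor stays above 1/2^k and the growth of l wins
  again. The arity r only has to place the threshold ((r + 1) / r)^r / (r - 1) strictly between the
  two local extrema; for k = 8 the choice r = 60 does so with room to spare. The intervals of
  uniqueness contain their end points, so the existence of an asymmetric fixed point must be decided
  exactly, not estimated. Hence the activity is expressed through w instead of iterating the
  recursion at a given activity: everything rests on the strict comparison of w > 1 with w = 1,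
  together with continuity and growth in w.\<close>

definition cyl :: "(nat \<Rightarrow> nat \<Rightarrow> bool) \<Rightarrow> nat set \<Rightarrow> (nat \<Rightarrow> color) \<Rightarrow> (nat \<Rightarrow> color) set" where
  "cyl E W \<xi> = {\<phi> \<in> homs E. \<forall>v\<in>W. \<phi> v = \<xi> v}"

text \<open>One family covers both sigma-algebras in play: V = \<open>UNIV\<close> gives that of the
  configuration space, V = \<open>- U\<close> the one on which a Gibbs measure is
  conditioned.\<close>

definition coord_alg :: "(nat \<Rightarrow> nat \<Rightarrow> bool) \<Rightarrow> nat set \<Rightarrow> (nat \<Rightarrow> color) measure" where
  "coord_alg E V = sigma (homs E) {{\<phi> \<in> homs E. \<phi> v \<in> A} | v A. v \<in> V}"

lemma UNIV_color: "UNIV = {Green, Yellow, Red}"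
  by (auto intro: color.exhaust)

instance color :: finite
  by standard (simp add: UNIV_color)

lemma all_yellow_in_homs: "(\<lambda>_. Yellow) \<in> homs E"
  by (simp add: homs_def hinge_adj_def)

lemma space_config_space: "space (config_space E) = homs E"
  by (auto simp: config_space_def space_restrict_space space_PiM)

lemma space_coord_alg: "space (coord_alg E V) = homs E"
  unfolding coord_alg_def by (rule space_measure_of) auto

lemma sets_coord_alg:
  "sets (coord_alg E V) = sigma_sets (homs E) {{\<phi> \<in> homs E. \<phi> v \<in> A} | v A. v \<in> V}"
  unfolding coord_alg_def by (rule sets_measure_of) auto

lemma outside_algebra_eq: "outside_algebra E U = coord_alg E (- U)"
  by (simp add: outside_algebra_def coord_alg_def space_config_space)

text \<open>The product sigma-algebra is generated by one-coordinate events, and the trace of a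
  generated sigma-algebra is generated by the traces of the generators.\<close>

lemma sets_config_space: "sets (config_space E) = sets (coord_alg E UNIV)"
proof -
  let ?S = "{{f. f i \<in> A} | i A. (i::nat) \<in> UNIV \<and> (A::color set) \<in> UNIV}"
  have S: "sets (PiM UNIV (\<lambda>_::nat. count_space (UNIV::color set))) = sets (sigma UNIV ?S)"
    by (simp add: sets_PiM_single)
  have "sets (config_space E) = sets (vimage_algebra (homs E) (\<lambda>x. x) (PiM UNIV (\<lambda>_. count_space UNIV)))"
    unfolding config_space_def by (rule restrict_space_eq_vimage_algebra) (auto simp: space_PiM)
  also have "\<dots> = sets (vimage_algebra (homs E) (\<lambda>x. x) (sigma UNIV ?S))"
    by (rule sets_vimage_algebra_cong[OF S])
  also have "vimage_algebra (homs E) (\<lambda>x. x) (sigma UNIV ?S)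
      = sigma (homs E) {(\<lambda>x. x) -` A \<inter> homs E | A. A \<in> ?S}"
    by (rule vimage_algebra_sigma) auto
  also have "{(\<lambda>x. x) -` A \<inter> homs E | A. A \<in> ?S} = {{\<phi> \<in> homs E. \<phi> v \<in> A} | v A. v \<in> UNIV}"
  proof (intro set_eqI iffI)
    fix X assume "X \<in> {(\<lambda>x. x) -` A \<inter> homs E | A. A \<in> ?S}"
    then obtain i B where "X = (\<lambda>x. x) -` {f. f i \<in> B} \<inter> homs E" by blast
    then have "X = {\<phi> \<in> homs E. \<phi> i \<in> B}" by auto
    then show "X \<in> {{\<phi> \<in> homs E. \<phi> v \<in> A} | v A. v \<in> UNIV}" by blast
  next
    fix X assume "X \<in> {{\<phi> \<in> homs E. \<phi> v \<in> A} | v A. v \<in> UNIV}"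
    then obtain i B where "X = {\<phi> \<in> homs E. \<phi> i \<in> B}" by blast
    then have "X = (\<lambda>x. x) -` {f. f i \<in> B} \<inter> homs E" by auto
    then show "X \<in> {(\<lambda>x. x) -` A \<inter> homs E | A. A \<in> ?S}" by blast
  qed
  finally show ?thesis by (simp add: coord_alg_def)
qed

lemma cyl_in_coord_alg:
  assumes "finite W" "W \<subseteq> V"
  shows "cyl E W \<xi> \<in> sets (coord_alg E V)"
proof -
  have "{\<phi> \<in> space (coord_alg E V). \<forall>v\<in>W. \<phi> v = \<xi> v} \<in> sets (coord_alg E V)"
  proof (rule sets.sets_Collect_finite_All[OF _ assms(1)])
    fix v assume "v \<in> W"
    then have "{\<phi> \<in> homs E. \<phi> v \<in> {\<xi> v}} \<in> sets (coord_alg E V)"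
      unfolding sets_coord_alg using assms(2) by (intro sigma_sets.Basic) blast
    then show "{\<phi> \<in> space (coord_alg E V). \<phi> v = \<xi> v} \<in> sets (coord_alg E V)"
      by (simp add: space_coord_alg)
  qed
  then show ?thesis by (simp add: cyl_def space_coord_alg)
qed

lemma finite_restrict_range: "finite W \<Longrightarrow> finite ((\<lambda>\<phi>. restrict \<phi> W) ` (A :: (nat \<Rightarrow> color) set))"
proof (rule finite_subset)
  show "(\<lambda>\<phi>. restrict \<phi> W) ` A \<subseteq> PiE W (\<lambda>_. UNIV)" by auto
  show "finite W \<Longrightarrow> finite (PiE W (\<lambda>_. UNIV :: color set))" by (rule finite_PiE) auto
qed

text \<open>For finite W there are finitely many restrictions to W, so an event that only looks at W
  becomes a finite union of cylinders and is measurable.\<close>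

lemma local_event_eq:
  assumes "A \<subseteq> homs E"
    and "\<And>\<phi> \<psi>. \<phi> \<in> A \<Longrightarrow> \<psi> \<in> homs E \<Longrightarrow> (\<forall>v\<in>W. \<psi> v = \<phi> v) \<Longrightarrow> \<psi> \<in> A"
  shows "A = (\<Union>\<zeta>\<in>(\<lambda>\<phi>. restrict \<phi> W) ` A. cyl E W \<zeta>)"
proof (intro set_eqI iffI)
  fix \<phi> assume "\<phi> \<in> A"
  then show "\<phi> \<in> (\<Union>\<zeta>\<in>(\<lambda>\<phi>. restrict \<phi> W) ` A. cyl E W \<zeta>)"
    using assms(1) by (auto simp: cyl_def intro!: bexI[of _ \<phi>])
next
  fix \<psi> assume "\<psi> \<in> (\<Union>\<zeta>\<in>(\<lambda>\<phi>. restrict \<phi> W) ` A. cyl E W \<zeta>)"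
  then show "\<psi> \<in> A" using assms(2) by (auto simp: cyl_def)
qed

lemma local_event_in_coord_alg:
  assumes "finite W" "W \<subseteq> V" "A \<subseteq> homs E"
    and "\<And>\<phi> \<psi>. \<phi> \<in> A \<Longrightarrow> \<psi> \<in> homs E \<Longrightarrow> (\<forall>v\<in>W. \<psi> v = \<phi> v) \<Longrightarrow> \<psi> \<in> A"
  shows "A \<in> sets (coord_alg E V)"
proof -
  have "(\<Union>\<zeta>\<in>(\<lambda>\<phi>. restrict \<phi> W) ` A. cyl E W \<zeta>) \<in> sets (coord_alg E V)"
    using assms by (intro sets.finite_UN finite_restrict_range cyl_in_coord_alg) auto
  then show ?thesis by (simp only: local_event_eq[OF assms(3,4), symmetric])
qed

lemma local_function_measurable:
  fixes f :: "(nat \<Rightarrow> color) \<Rightarrow> real"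
  assumes "finite W" "W \<subseteq> V"
    and "\<And>\<phi> \<psi>. \<phi> \<in> homs E \<Longrightarrow> \<psi> \<in> homs E \<Longrightarrow> (\<forall>v\<in>W. \<psi> v = \<phi> v) \<Longrightarrow> f \<psi> = f \<phi>"
  shows "f \<in> borel_measurable (coord_alg E V)"
proof (rule measurableI)
  fix B :: "real set"
  show "f -` B \<inter> space (coord_alg E V) \<in> sets (coord_alg E V)"
  proof (rule local_event_in_coord_alg[OF assms(1,2)])
    fix \<phi> \<psi> assume "\<phi> \<in> f -` B \<inter> space (coord_alg E V)" "\<psi> \<in> homs E" "\<forall>v\<in>W. \<psi> v = \<phi> v"
    moreover from this have "f \<psi> = f \<phi>" by (intro assms(3)) (simp_all add: space_coord_alg)
    ultimately show "\<psi> \<in> f -` B \<inter> space (coord_alg E V)" by (simp add: space_coord_alg)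
  qed (simp add: space_coord_alg)
qed simp

section \<open>Generating families of cylinders over initial segments\<close>

definition cyl_basis :: "(nat \<Rightarrow> nat \<Rightarrow> bool) \<Rightarrow> nat set \<Rightarrow> nat \<Rightarrow> (nat \<Rightarrow> color) set set" where
  "cyl_basis E V n0 = insert {} {cyl E ({..<n} \<inter> V) \<xi> | n \<xi>. n0 \<le> n}"

text \<open>Because the index sets grow along a chain, two cylinders are either nested or disjoint.
  The lower bound \<open>n0\<close> keeps this property and allows formulas for cylinder
  probabilities that hold only on large segments.\<close>

lemma Int_stable_cyl_basis: "Int_stable (cyl_basis E V n0)"
proof -
  have *: "cyl E ({..<n} \<inter> V) \<xi> \<inter> cyl E ({..<m} \<inter> V) \<zeta> \<in> {{}, cyl E ({..<m} \<inter> V) \<zeta>}"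
    if "n \<le> m" for n m :: nat and \<xi> \<zeta>
  proof (cases "\<forall>v\<in>{..<n} \<inter> V. \<xi> v = \<zeta> v")
    case True
    have "{..<n} \<inter> V \<subseteq> {..<m} \<inter> V" using that by auto
    then have "cyl E ({..<m} \<inter> V) \<zeta> \<subseteq> cyl E ({..<n} \<inter> V) \<xi>"
      unfolding cyl_def using True by (smt (verit) Collect_mono subsetD)
    then show ?thesis by blast
  next
    case False
    then obtain v where v: "v < n" "v \<in> V" "\<xi> v \<noteq> \<zeta> v" by auto
    then have "v < m" using that by simp
    have False if "\<phi> \<in> cyl E ({..<n} \<inter> V) \<xi>" "\<phi> \<in> cyl E ({..<m} \<inter> V) \<zeta>" for \<phi>
    proof -
      have "v \<in> {..<n} \<inter> V" "v \<in> {..<m} \<inter> V" using v \<open>v < m\<close> by auto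
      then have "\<phi> v = \<xi> v" "\<phi> v = \<zeta> v" using that unfolding cyl_def by blast+
      then show False using v by simp
    qed
    then show ?thesis by blast
  qed
  show ?thesis
  proof (rule Int_stableI)
    fix a b assume ab: "a \<in> cyl_basis E V n0" "b \<in> cyl_basis E V n0"
    show "a \<inter> b \<in> cyl_basis E V n0"
    proof (cases "a = {} \<or> b = {}")
      case True
      then show ?thesis by (elim disjE) (simp_all add: cyl_basis_def)
    next
      case False
      with ab obtain n \<xi> m \<zeta> where ab': "a = cyl E ({..<n} \<inter> V) \<xi>" "b = cyl E ({..<m} \<inter> V) \<zeta>" "n0 \<le> n" "n0 \<le> m"
        unfolding cyl_basis_def by blast
      have "a \<inter> b \<in> {{}, a, b}"
      proof (cases "n \<le> m")
        case True
        then show ?thesis using *[OF True, of \<xi> \<zeta>] ab'(1,2) by blast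
      next
        case False
        then have "b \<inter> a \<in> {{}, a}" using *[of m n \<zeta> \<xi>] ab'(1,2) by simp
        then show ?thesis by (auto simp: Int_commute)
      qed
      moreover have "{} \<in> cyl_basis E V n0" by (simp add: cyl_basis_def)
      ultimately show ?thesis using ab by (elim insertE emptyE) simp_all
    qed
  qed
qed

lemma cyl_basis_subset: "cyl_basis E V n0 \<subseteq> Pow (homs E)"
  by (auto simp: cyl_basis_def cyl_def)

lemma sigma_sets_cyl_basis: "sets (coord_alg E V) = sigma_sets (homs E) (cyl_basis E V n0)"
proof
  show "sigma_sets (homs E) (cyl_basis E V n0) \<subseteq> sets (coord_alg E V)"
    by (subst space_coord_alg[symmetric, of E V], rule sets.sigma_sets_subset)
       (auto simp: cyl_basis_def intro!: cyl_in_coord_alg)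
  let ?M = "sigma (homs E) (cyl_basis E V n0)"
  have M: "sets ?M = sigma_sets (homs E) (cyl_basis E V n0)" "space ?M = homs E"
    using cyl_basis_subset by (auto simp: sets_measure_of space_measure_of)
  have "{\<phi> \<in> homs E. \<phi> v \<in> A} \<in> sets ?M" if "v \<in> V" for v A
  proof -
    let ?W = "{..<max n0 (Suc v)} \<inter> V" and ?A = "{\<phi> \<in> homs E. \<phi> v \<in> A}"
    have "v \<in> ?W" using that by simp
    then have "?A = (\<Union>\<zeta>\<in>(\<lambda>\<phi>. restrict \<phi> ?W) ` ?A. cyl E ?W \<zeta>)"
      by (intro local_event_eq) auto
    also have "\<dots> \<in> sets ?M"
    proof (intro sets.finite_UN finite_restrict_range)
      fix \<zeta>
      have "cyl E ?W \<zeta> \<in> cyl_basis E V n0"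
        unfolding cyl_basis_def
        by (intro insertI2 CollectI exI[of _ "max n0 (Suc v)"] exI[of _ \<zeta>] conjI refl max.cobounded1)
      then show "cyl E ?W \<zeta> \<in> sets ?M" unfolding M by (rule sigma_sets.Basic)
    qed simp
    finally show ?thesis .
  qed
  then have "sigma_sets (space ?M) {{\<phi> \<in> homs E. \<phi> v \<in> A} | v A. v \<in> V} \<subseteq> sets ?M"
    by (intro sets.sigma_sets_subset) auto
  then show "sets (coord_alg E V) \<subseteq> sigma_sets (homs E) (cyl_basis E V n0)"
    by (simp add: sets_coord_alg M)
qed

lemma measure_eq_by_cylinders:
  assumes "prob_space P" "prob_space Q" "sets P = sets (config_space E)" "sets Q = sets (config_space E)"
    and eq: "\<And>n \<xi>. n0 \<le> n \<Longrightarrow> measure P (cyl E {..<n} \<xi>) = measure Q (cyl E {..<n} \<xi>)"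
  shows "P = Q"
proof -
  interpret P: prob_space P by fact
  interpret Q: prob_space Q by fact
  have sp: "space P = homs E" "space Q = homs E"
    using assms(3,4)[THEN sets_eq_imp_space_eq] by (auto simp: space_config_space)
  show ?thesis
  proof (rule measure_eqI_generator_eq_countable[OF Int_stable_cyl_basis cyl_basis_subset])
    fix X assume "X \<in> cyl_basis E UNIV n0"
    then show "emeasure P X = emeasure Q X"
      using eq by (auto simp: cyl_basis_def P.emeasure_eq_measure Q.emeasure_eq_measure)
  next
    \<comment> \<open>The uniqueness theorem for measures on a generator also wants a countable
      cover by generators of finite mass; the cylinders of level \<open>n0\<close> provide a finite
      one.\<close>
    let ?C = "(\<lambda>\<xi>. cyl E {..<n0} \<xi>) ` (\<lambda>\<phi>. restrict \<phi> {..<n0}) ` homs E"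
    show "?C \<subseteq> cyl_basis E UNIV n0" by (auto simp: cyl_basis_def)
    show "countable ?C" by (intro countable_finite finite_imageI finite_restrict_range) simp
    show "\<Union> ?C = homs E"
      by (rule local_event_eq[symmetric]) auto
    show "emeasure P a \<noteq> \<infinity>" for a by simp
    show "sets P = sigma_sets (homs E) (cyl_basis E UNIV n0)" "sets Q = sigma_sets (homs E) (cyl_basis E UNIV n0)"
      unfolding assms(3,4) sets_config_space by (rule sigma_sets_cyl_basis)+
  qed
qed

section \<open>Finite-volume conditional distributions\<close>

definition fillings :: "(nat \<Rightarrow> nat \<Rightarrow> bool) \<Rightarrow> nat set \<Rightarrow> (nat \<Rightarrow> color) \<Rightarrow> (nat \<Rightarrow> color) set" where
  "fillings E U \<psi> = {\<phi> \<in> homs E. \<forall>v. v \<notin> U \<longrightarrow> \<phi> v = \<psi> v}"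

definition pfun :: "(nat \<Rightarrow> nat \<Rightarrow> bool) \<Rightarrow> (color \<Rightarrow> real) \<Rightarrow> nat set \<Rightarrow> (nat \<Rightarrow> color) \<Rightarrow> real" where
  "pfun E \<mu> U \<psi> = (\<Sum>\<phi>\<in>fillings E U \<psi>. weight \<mu> U \<phi>)"

text \<open>In \<open>spec_prob\<close> a single argument supplies both the pattern on U and the
  boundary condition. Here they are separated, so that the boundary condition can be integrated
  while the pattern stays fixed.\<close>

definition local_prob :: "(nat \<Rightarrow> nat \<Rightarrow> bool) \<Rightarrow> (color \<Rightarrow> real) \<Rightarrow> nat set \<Rightarrow> (nat \<Rightarrow> color) \<Rightarrow> (nat \<Rightarrow> color) \<Rightarrow> real" where
  "local_prob E \<mu> U \<eta> \<psi> = (\<Sum>\<phi>\<in>{\<phi> \<in> fillings E U \<psi>. \<forall>v\<in>U. \<phi> v = \<eta> v}. weight \<mu> U \<phi>) / pfun E \<mu> U \<psi>"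

lemma finite_fillings:
  assumes "finite U"
  shows "finite (fillings E U \<psi>)"
proof (rule inj_on_finite)
  show "inj_on (\<lambda>\<phi>. restrict \<phi> U) (fillings E U \<psi>)"
  proof (rule inj_onI, rule ext)
    fix \<phi> \<phi>' v assume *: "\<phi> \<in> fillings E U \<psi>" "\<phi>' \<in> fillings E U \<psi>" "restrict \<phi> U = restrict \<phi>' U"
    show "\<phi> v = \<phi>' v"
    proof (cases "v \<in> U")
      case True
      then show ?thesis using fun_cong[OF *(3), of v] by simp
    next
      case False
      then show ?thesis using *(1,2) by (simp add: fillings_def)
    qed
  qed
  show "(\<lambda>\<phi>. restrict \<phi> U) ` fillings E U \<psi> \<subseteq> PiE U (\<lambda>_. UNIV)" by auto
  show "finite (PiE U (\<lambda>_. UNIV :: color set))" using assms by (rule finite_PiE) simp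
qed

lemma self_in_fillings: "\<psi> \<in> homs E \<Longrightarrow> \<psi> \<in> fillings E U \<psi>"
  by (simp add: fillings_def)

lemma weight_pos: "(\<And>c. 0 < \<mu> c) \<Longrightarrow> 0 < weight \<mu> U \<phi>"
  by (simp add: weight_def prod_pos)

lemma pfun_pos:
  assumes "finite U" "\<And>c. 0 < \<mu> c" "\<psi> \<in> homs E"
  shows "0 < pfun E \<mu> U \<psi>"
  unfolding pfun_def using self_in_fillings[OF assms(3)]
  by (intro sum_pos finite_fillings weight_pos assms(1,2)) auto

lemma finite_bdry:
  assumes "board E" "finite U"
  shows "finite (bdry E U)"
proof (rule finite_subset)
  show "bdry E U \<subseteq> (\<Union>u\<in>U. {w. E u w})" by (auto simp: bdry_def)
  show "finite (\<Union>u\<in>U. {w. E u w})" using assms by (auto simp: board_def)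
qed

text \<open>Changing a homomorphism on U can only spoil edges that meet U, and by symmetry each of
  these may be read as starting in U.\<close>

lemma homs_boardI:
  assumes "board E" "\<psi> \<in> homs E" "\<And>v. v \<notin> U \<Longrightarrow> \<phi> v = \<psi> v"
    and "\<And>u w. u \<in> U \<Longrightarrow> E u w \<Longrightarrow> hinge_adj (\<phi> u) (\<phi> w)"
  shows "\<phi> \<in> homs E"
proof -
  have sym: "hinge_adj c d \<Longrightarrow> hinge_adj d c" for c d by (auto simp: hinge_adj_def)
  have "hinge_adj (\<phi> v) (\<phi> w)" if "E v w" for v w
  proof -
    have "E w v" using assms(1) that by (simp add: board_def)
    consider "v \<in> U" | "w \<in> U" | "v \<notin> U" "w \<notin> U" by blast
    then show ?thesis
    proof cases
      case 3
      then show ?thesis using assms(2,3) that by (simp add: homs_def)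
    qed (use assms(4) that \<open>E w v\<close> sym in blast)+
  qed
  then show ?thesis by (simp add: homs_def)
qed

text \<open>The specification counts partial configurations on \<open>plus E U\<close>, everything
  else here works with total ones. The inverse translation pastes the values on U into \<psi>, which
  is harmless because all neighbours of U lie in \<open>plus E U\<close>.\<close>

lemma restrict_fillings_bij:
  assumes "board E" "\<psi> \<in> homs E"
  shows "bij_betw (\<lambda>\<phi>. restrict \<phi> (plus E U)) (fillings E U \<psi>)
    ({\<phi>. \<forall>v\<in>bdry E U. \<phi> v = \<psi> v} \<inter> fin_homs E (plus E U))"
proof (rule bij_betw_byWitness[where f' = "\<lambda>\<phi>. override_on \<psi> \<phi> U"])
  have disj: "v \<in> bdry E U \<Longrightarrow> v \<notin> U" for v by (simp add: bdry_def)
  show "\<forall>\<phi>\<in>fillings E U \<psi>. override_on \<psi> (restrict \<phi> (plus E U)) U = \<phi>"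
    by (auto simp: fillings_def override_on_def plus_def)
  show "\<forall>\<phi>\<in>{\<phi>. \<forall>v\<in>bdry E U. \<phi> v = \<psi> v} \<inter> fin_homs E (plus E U).
      restrict (override_on \<psi> \<phi> U) (plus E U) = \<phi>"
  proof
    fix \<phi> assume *: "\<phi> \<in> {\<phi>. \<forall>v\<in>bdry E U. \<phi> v = \<psi> v} \<inter> fin_homs E (plus E U)"
    show "restrict (override_on \<psi> \<phi> U) (plus E U) = \<phi>"
    proof
      fix v
      consider "v \<in> U" | "v \<in> bdry E U" "v \<notin> U" | "v \<notin> plus E U" by (auto simp: plus_def)
      then show "restrict (override_on \<psi> \<phi> U) (plus E U) v = \<phi> v"
        using * by cases (auto simp: plus_def override_on_def fin_homs_def PiE_def extensional_def)
    qed
  qed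
  show "(\<lambda>\<phi>. restrict \<phi> (plus E U)) ` fillings E U \<psi>
      \<subseteq> {\<phi>. \<forall>v\<in>bdry E U. \<phi> v = \<psi> v} \<inter> fin_homs E (plus E U)"
    using disj by (auto simp: fillings_def fin_homs_def plus_def homs_def split: if_splits)
  show "(\<lambda>\<phi>. override_on \<psi> \<phi> U) ` ({\<phi>. \<forall>v\<in>bdry E U. \<phi> v = \<psi> v} \<inter> fin_homs E (plus E U)) \<subseteq> fillings E U \<psi>"
  proof
    fix \<theta> assume "\<theta> \<in> (\<lambda>\<phi>. override_on \<psi> \<phi> U) ` ({\<phi>. \<forall>v\<in>bdry E U. \<phi> v = \<psi> v} \<inter> fin_homs E (plus E U))"
    then obtain \<phi> where \<theta>: "\<theta> = override_on \<psi> \<phi> U" and \<phi>: "\<forall>v\<in>bdry E U. \<phi> v = \<psi> v" "\<phi> \<in> fin_homs E (plus E U)"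
      by auto
    have "\<theta> \<in> homs E"
    proof (rule homs_boardI[OF assms, of U])
      fix u w assume uw: "u \<in> U" "E u w"
      then have "w \<in> plus E U" "u \<in> plus E U" by (auto simp: plus_def bdry_def)
      moreover from this uw have "\<theta> w = \<phi> w" "\<theta> u = \<phi> u"
        using \<phi>(1) by (auto simp: \<theta> override_on_def plus_def)
      ultimately show "hinge_adj (\<theta> u) (\<theta> w)" using \<phi>(2) uw by (simp add: fin_homs_def)
    qed (simp add: \<theta>)
    then show "\<theta> \<in> fillings E U \<psi>" by (simp add: fillings_def \<theta>)
  qed
qed

lemma weight_plus:
  assumes "board E" "finite U" "\<And>v. v \<in> bdry E U \<Longrightarrow> \<phi> v = \<psi> v"
  shows "weight \<mu> (plus E U) (restrict \<phi> (plus E U)) = weight \<mu> U \<phi> * weight \<mu> (bdry E U) \<psi>"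
proof -
  have "weight \<mu> (plus E U) (restrict \<phi> (plus E U)) = (\<Prod>v\<in>U \<union> bdry E U. \<mu> (\<phi> v))"
    unfolding weight_def by (rule prod.cong) (auto simp: plus_def)
  also have "\<dots> = (\<Prod>v\<in>U. \<mu> (\<phi> v)) * (\<Prod>v\<in>bdry E U. \<mu> (\<phi> v))"
    by (rule prod.union_disjoint) (use assms finite_bdry in \<open>auto simp: bdry_def\<close>)
  also have "(\<Prod>v\<in>bdry E U. \<mu> (\<phi> v)) = weight \<mu> (bdry E U) \<psi>"
    unfolding weight_def by (rule prod.cong) (use assms in auto)
  finally show ?thesis by (simp add: weight_def)
qed

text \<open>Both the weight of the boundary and the normalisation on \<open>U\<^sup>+\<close> cancel in the
  specification.\<close>

lemma spec_prob_eq: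
  assumes "board E" "finite U" "\<And>c. 0 < \<mu> c" "\<psi> \<in> homs E"
  shows "spec_prob E \<mu> U \<psi> = weight \<mu> U \<psi> / pfun E \<mu> U \<psi>"
proof -
  let ?W = "plus E U" and ?b = "weight \<mu> (bdry E U) \<psi>"
  let ?A = "{\<phi>. \<forall>v\<in>U. \<phi> v = \<psi> v}" and ?B = "{\<phi>. \<forall>v\<in>bdry E U. \<phi> v = \<psi> v}"
  let ?r = "\<lambda>\<phi>. restrict \<phi> ?W"
  have finW: "finite ?W" using assms(1,2) finite_bdry by (simp add: plus_def)
  have fin: "finite (fin_homs E ?W)"
    by (rule finite_subset[OF _ finite_PiE[OF finW, of "\<lambda>_. UNIV"]]) (auto simp: fin_homs_def)
  define Z where "Z = (\<Sum>\<phi>\<in>fin_homs E ?W. weight \<mu> ?W \<phi>)"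
  have "(\<lambda>v. if v \<in> ?W then Yellow else undefined) \<in> fin_homs E ?W"
    by (auto simp: fin_homs_def hinge_adj_def PiE_def extensional_def)
  then have Z: "0 < Z"
    unfolding Z_def by (intro sum_pos fin weight_pos assms) auto
  have bij: "bij_betw ?r (fillings E U \<psi>) (?B \<inter> fin_homs E ?W)"
    by (rule restrict_fillings_bij) fact+
  have wt: "weight \<mu> ?W (?r \<phi>) = weight \<mu> U \<phi> * ?b" if "\<phi> \<in> fillings E U \<psi>" for \<phi>
    by (rule weight_plus[OF assms(1,2)]) (use that in \<open>auto simp: fillings_def bdry_def\<close>)
  have "(\<Sum>\<phi>\<in>?B \<inter> fin_homs E ?W. weight \<mu> ?W \<phi>) = (\<Sum>\<phi>\<in>fillings E U \<psi>. weight \<mu> ?W (?r \<phi>))"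
    by (rule sum.reindex_bij_betw[OF bij, symmetric])
  also have "\<dots> = pfun E \<mu> U \<psi> * ?b"
    unfolding pfun_def sum_distrib_right using wt by (intro sum.cong) auto
  finally have B: "mu_prob E \<mu> ?W ?B = pfun E \<mu> U \<psi> * ?b / Z"
    by (simp add: mu_prob_def Z_def)
  have "?A \<inter> ?B \<inter> fin_homs E ?W = {?r \<psi>}"
  proof (intro set_eqI iffI)
    fix \<phi> assume \<phi>: "\<phi> \<in> ?A \<inter> ?B \<inter> fin_homs E ?W"
    have "\<phi> v = ?r \<psi> v" for v
      using \<phi> by (cases "v \<in> ?W") (auto simp: fin_homs_def PiE_def extensional_def plus_def)
    then show "\<phi> \<in> {?r \<psi>}" by auto
  next
    fix \<phi> assume "\<phi> \<in> {?r \<psi>}"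
    then show "\<phi> \<in> ?A \<inter> ?B \<inter> fin_homs E ?W"
      using assms(4) by (auto simp: plus_def fin_homs_def homs_def)
  qed
  then have A: "mu_prob E \<mu> ?W (?A \<inter> ?B) = weight \<mu> U \<psi> * ?b / Z"
    using wt[OF self_in_fillings[OF assms(4)]] by (simp add: mu_prob_def Z_def)
  have "0 < ?b" "0 < pfun E \<mu> U \<psi>" using weight_pos pfun_pos assms by blast+
  then show ?thesis
    unfolding spec_prob_def Let_def A B using Z by simp
qed

lemma local_prob_self:
  assumes "\<psi> \<in> homs E" "\<forall>v\<in>U. \<psi> v = \<eta> v"
  shows "local_prob E \<mu> U \<eta> \<psi> = weight \<mu> U \<psi> / pfun E \<mu> U \<psi>"
proof -
  have "{\<phi> \<in> fillings E U \<psi>. \<forall>v\<in>U. \<phi> v = \<eta> v} = {\<psi>}"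
  proof (intro set_eqI iffI)
    fix \<phi> assume *: "\<phi> \<in> {\<phi> \<in> fillings E U \<psi>. \<forall>v\<in>U. \<phi> v = \<eta> v}"
    have "\<phi> v = \<psi> v" for v using * assms by (cases "v \<in> U") (auto simp: fillings_def)
    then show "\<phi> \<in> {\<psi>}" by auto
  qed (use assms in \<open>auto simp: fillings_def\<close>)
  then show ?thesis by (simp add: local_prob_def)
qed

lemma local_prob_nonneg:
  assumes "finite U" "\<And>c. 0 < \<mu> c" "\<psi> \<in> homs E"
  shows "0 \<le> local_prob E \<mu> U \<eta> \<psi>"
  unfolding local_prob_def using assms
  by (intro divide_nonneg_nonneg sum_nonneg less_imp_le[OF pfun_pos] less_imp_le[OF weight_pos]) auto

lemma local_prob_le_1:
  assumes "finite U" "\<And>c. 0 < \<mu> c" "\<psi> \<in> homs E"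
  shows "local_prob E \<mu> U \<eta> \<psi> \<le> 1"
proof -
  have "(\<Sum>\<phi>\<in>{\<phi> \<in> fillings E U \<psi>. \<forall>v\<in>U. \<phi> v = \<eta> v}. weight \<mu> U \<phi>) \<le> pfun E \<mu> U \<psi>"
    unfolding pfun_def using assms
    by (intro sum_mono2 finite_fillings less_imp_le[OF weight_pos]) auto
  then show ?thesis unfolding local_prob_def using pfun_pos[OF assms] by simp
qed

text \<open>With T the set of all patterns this yields total mass one; with T the patterns extending
  a given one on a smaller set it yields the marginal there.\<close>

lemma sum_local_prob_subset:
  assumes "finite U" "T \<subseteq> PiE U (\<lambda>_. UNIV)"
  shows "(\<Sum>\<eta>\<in>T. local_prob E \<mu> U \<eta> \<psi>)
    = (\<Sum>\<phi>\<in>{\<phi> \<in> fillings E U \<psi>. restrict \<phi> U \<in> T}. weight \<mu> U \<phi>) / pfun E \<mu> U \<psi>"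
proof -
  have "finite (PiE U (\<lambda>_. UNIV :: color set))" using assms(1) by (rule finite_PiE) simp
  then have fT: "finite T" using assms(2) finite_subset by blast
  have eq: "{\<phi> \<in> fillings E U \<psi>. \<forall>v\<in>U. \<phi> v = \<eta> v}
      = {\<phi> \<in> {\<phi> \<in> fillings E U \<psi>. restrict \<phi> U \<in> T}. restrict \<phi> U = \<eta>}" if "\<eta> \<in> T" for \<eta>
  proof -
    have "(\<forall>v\<in>U. \<phi> v = \<eta> v) \<longleftrightarrow> restrict \<phi> U = \<eta>" for \<phi>
    proof -
      have "\<eta> \<in> PiE U (\<lambda>_. UNIV)" using that assms(2) by auto
      then show ?thesis by (auto simp: fun_eq_iff PiE_def extensional_def restrict_def)
    qed
    then show ?thesis using that by auto
  qed
  have "(\<Sum>\<eta>\<in>T. \<Sum>\<phi>\<in>{\<phi> \<in> fillings E U \<psi>. \<forall>v\<in>U. \<phi> v = \<eta> v}. weight \<mu> U \<phi>)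
      = (\<Sum>\<eta>\<in>T. \<Sum>\<phi>\<in>{\<phi> \<in> {\<phi> \<in> fillings E U \<psi>. restrict \<phi> U \<in> T}. restrict \<phi> U = \<eta>}. weight \<mu> U \<phi>)"
    by (rule sum.cong[OF refl]) (simp only: eq)
  also have "\<dots> = (\<Sum>\<phi>\<in>{\<phi> \<in> fillings E U \<psi>. restrict \<phi> U \<in> T}. weight \<mu> U \<phi>)"
    by (rule sum.group) (use fT finite_fillings[OF assms(1)] in auto)
  finally show ?thesis by (simp add: local_prob_def flip: sum_divide_distrib)
qed

lemma sum_local_prob:
  assumes "finite U" "\<And>c. 0 < \<mu> c" "\<psi> \<in> homs E"
  shows "(\<Sum>\<eta>\<in>PiE U (\<lambda>_. UNIV). local_prob E \<mu> U \<eta> \<psi>) = 1"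
proof -
  have "0 < pfun E \<mu> U \<psi>" by (rule pfun_pos) fact+
  moreover have "{\<phi> \<in> fillings E U \<psi>. restrict \<phi> U \<in> PiE U (\<lambda>_. UNIV)} = fillings E U \<psi>" by simp
  ultimately show ?thesis
    unfolding sum_local_prob_subset[OF assms(1) subset_refl] by (simp add: pfun_def)
qed

text \<open>The spatial Markov property: exchanging the exterior \<psi> for \<psi>' maps fillings to
  fillings without changing their weight, since U has no edge to the complement of
  \<open>plus E U\<close>.\<close>

lemma local_prob_cong:
  assumes "board E" "\<psi> \<in> homs E" "\<psi>' \<in> homs E" "\<And>v. v \<in> bdry E U \<Longrightarrow> \<psi> v = \<psi>' v"
  shows "local_prob E \<mu> U \<eta> \<psi> = local_prob E \<mu> U \<eta> \<psi>'"
proof -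
  have in_fillings: "override_on \<theta>' \<phi> U \<in> fillings E U \<theta>'"
    if "\<theta> \<in> homs E" "\<theta>' \<in> homs E" "\<And>v. v \<in> bdry E U \<Longrightarrow> \<theta> v = \<theta>' v" "\<phi> \<in> fillings E U \<theta>" for \<theta> \<theta>' \<phi>
  proof -
    have "override_on \<theta>' \<phi> U \<in> homs E"
    proof (rule homs_boardI[OF assms(1) that(2), of U])
      fix u w assume uw: "u \<in> U" "E u w"
      have "w \<in> U \<or> w \<in> bdry E U" using uw by (auto simp: bdry_def)
      then have "override_on \<theta>' \<phi> U w = \<phi> w"
        using that(3,4) by (auto simp: fillings_def override_on_def)
      then show "hinge_adj (override_on \<theta>' \<phi> U u) (override_on \<theta>' \<phi> U w)"
        using that(4) uw by (simp add: fillings_def homs_def)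
    qed simp
    then show ?thesis by (simp add: fillings_def)
  qed
  have inv: "override_on \<theta> (override_on \<theta>' \<phi> U) U = \<phi>" if "\<phi> \<in> fillings E U \<theta>" for \<theta> \<theta>' \<phi>
    using that by (auto simp: fillings_def override_on_def)
  have w: "weight \<mu> U (override_on \<theta> \<phi> U) = weight \<mu> U \<phi>" for \<theta> \<phi>
    unfolding weight_def by (rule prod.cong) auto
  note in1 = in_fillings[OF assms(2,3,4)] and in2 = in_fillings[OF assms(3,2) assms(4)[symmetric]]
  have "(\<Sum>\<phi>\<in>{\<phi> \<in> fillings E U \<psi>. \<forall>v\<in>U. \<phi> v = \<eta> v}. weight \<mu> U \<phi>)
      = (\<Sum>\<phi>\<in>{\<phi> \<in> fillings E U \<psi>'. \<forall>v\<in>U. \<phi> v = \<eta> v}. weight \<mu> U \<phi>)"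
    by (rule sum.reindex_bij_witness[of _ "\<lambda>\<phi>. override_on \<psi> \<phi> U" "\<lambda>\<phi>. override_on \<psi>' \<phi> U"])
       (auto simp: inv w in1 in2)
  moreover have "pfun E \<mu> U \<psi> = pfun E \<mu> U \<psi>'"
    unfolding pfun_def
    by (rule sum.reindex_bij_witness[of _ "\<lambda>\<phi>. override_on \<psi> \<phi> U" "\<lambda>\<phi>. override_on \<psi>' \<phi> U"])
       (auto simp: inv w in1 in2)
  ultimately show ?thesis by (simp add: local_prob_def)
qed

lemma local_prob_measurable:
  assumes "board E" "finite U"
  shows "local_prob E \<mu> U \<eta> \<in> borel_measurable (coord_alg E (- U))"
proof (rule local_function_measurable)
  show "finite (bdry E U)" using assms by (rule finite_bdry)
  show "bdry E U \<subseteq> - U" by (auto simp: bdry_def)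
  fix \<phi> \<psi> assume "\<phi> \<in> homs E" "\<psi> \<in> homs E" "\<forall>v\<in>bdry E U. \<psi> v = \<phi> v"
  then show "local_prob E \<mu> U \<eta> \<psi> = local_prob E \<mu> U \<eta> \<phi>" using assms(1) by (intro local_prob_cong) auto
qed

section \<open>Gibbs measures in terms of cylinder probabilities\<close>

lemma sets_coord_alg_mono:
  assumes "V \<subseteq> V'"
  shows "sets (coord_alg E V) \<subseteq> sets (coord_alg E V')"
  unfolding sets_coord_alg using assms by (intro sigma_sets_mono') auto

lemma subalgebra_outside:
  assumes "sets P = sets (config_space E)"
  shows "subalgebra P (outside_algebra E U)"
  unfolding subalgebra_def outside_algebra_eq space_coord_alg
  using sets_eq_imp_space_eq[OF assms] sets_coord_alg_mono[of "- U" UNIV E] assms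
  by (simp add: space_config_space sets_config_space)

lemma local_prob_measurable_config:
  assumes "board E" "finite U" "sets P = sets (config_space E)"
  shows "local_prob E \<mu> U \<eta> \<in> borel_measurable P"
  using measurable_from_subalg[OF subalgebra_outside[OF assms(3)]] local_prob_measurable[OF assms(1,2)]
  unfolding outside_algebra_eq by blast

lemma cyl_restrict: "cyl E U (restrict \<eta> U) = cyl E U \<eta>"
  by (auto simp: cyl_def)

lemma local_prob_restrict: "local_prob E \<mu> U (restrict \<eta> U) = local_prob E \<mu> U \<eta>"
  by (rule HOL.ext) (auto simp: local_prob_def intro!: arg_cong2[where f = "(/)"] sum.cong)

text \<open>The defining condition of a Gibbs measure constrains the conditional probability of the
  pattern \<open>\<eta>\<close> only at configurations that carry this pattern, so it only yields
  \<open>c\<^sup>2 = l c\<close> for the conditional probability \<open>c\<close> and the prescribed value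
  \<open>l\<close>. As both sum to 1 over all patterns, \<open>c = l\<close>.\<close>

lemma gibbs_cond_exp:
  assumes E: "board E" and U: "finite U" and \<mu>: "\<And>c. 0 < \<mu> c" and P: "gibbs E \<mu> P"
    and \<eta>: "\<eta> \<in> PiE U (\<lambda>_. UNIV)"
  shows "AE \<psi> in P. real_cond_exp P (outside_algebra E U) (indicator (cyl E U \<eta>)) \<psi> = local_prob E \<mu> U \<eta> \<psi>"
proof -
  interpret prob_space P using P by (simp add: gibbs_def)
  have sets: "sets P = sets (config_space E)" using P by (simp add: gibbs_def)
  have sp: "space P = homs E" using sets_eq_imp_space_eq[OF sets] by (simp add: space_config_space)
  let ?F = "outside_algebra E U"
  interpret finite_measure_subalgebra P ?F
    by unfold_locales (rule subalgebra_outside[OF sets])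
  have fP: "finite (PiE U (\<lambda>_. UNIV :: color set))" using U by (rule finite_PiE) simp
  have cyl[measurable]: "cyl E U \<eta> \<in> sets P" for \<eta>
    unfolding sets sets_config_space using U by (rule cyl_in_coord_alg) simp
  have locF[measurable]: "local_prob E \<mu> U \<eta> \<in> borel_measurable ?F" for \<eta>
    unfolding outside_algebra_eq by (rule local_prob_measurable) fact+
  have locP[measurable]: "local_prob E \<mu> U \<eta> \<in> borel_measurable P" for \<eta>
    by (rule local_prob_measurable_config) fact+
  define c where "c \<eta> = real_cond_exp P ?F (indicator (cyl E U \<eta>))" for \<eta>
  have cF[measurable]: "c \<eta> \<in> borel_measurable ?F" for \<eta> unfolding c_def by simp
  have cP[measurable]: "c \<eta> \<in> borel_measurable P" for \<eta> unfolding c_def by simp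
  have ind: "integrable P (indicator (cyl E U \<eta>) :: _ \<Rightarrow> real)" for \<eta>
    by (rule finite_measure.integrable_const_bound[of _ _ 1]) (auto simp: finite_measure_axioms)
  have c1: "AE \<psi> in P. 0 \<le> c \<eta> \<psi>" "AE \<psi> in P. c \<eta> \<psi> \<le> 1" for \<eta>
    unfolding c_def by (intro real_cond_exp_pos real_cond_exp_le_c ind AE_I2; simp)+
  have "AE \<psi> in P. c \<eta> \<psi> * c \<eta> \<psi> = local_prob E \<mu> U \<eta> \<psi> * c \<eta> \<psi>" for \<eta>
  proof -
    have "AE \<psi> in P. real_cond_exp P ?F (indicator {\<phi> \<in> space P. \<forall>v\<in>U. \<phi> v = \<psi> v}) \<psi> = spec_prob E \<mu> U \<psi>"
      using P U by (simp add: gibbs_def)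
    then have *: "AE \<psi> in P. c \<eta> \<psi> * indicator (cyl E U \<eta>) \<psi> = local_prob E \<mu> U \<eta> \<psi> * indicator (cyl E U \<eta>) \<psi>"
    proof (eventually_elim, cases)
      fix \<psi> assume **: "real_cond_exp P ?F (indicator {\<phi> \<in> space P. \<forall>v\<in>U. \<phi> v = \<psi> v}) \<psi> = spec_prob E \<mu> U \<psi>"
        and \<psi>: "\<psi> \<in> cyl E U \<eta>"
      then have "{\<phi> \<in> space P. \<forall>v\<in>U. \<phi> v = \<psi> v} = cyl E U \<eta>" by (auto simp: cyl_def sp)
      moreover have "spec_prob E \<mu> U \<psi> = local_prob E \<mu> U \<eta> \<psi>"
        using \<psi> by (subst local_prob_self) (auto simp: cyl_def intro!: spec_prob_eq assms)
      ultimately show "c \<eta> \<psi> * indicator (cyl E U \<eta>) \<psi> = local_prob E \<mu> U \<eta> \<psi> * indicator (cyl E U \<eta>) \<psi>"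
        using ** by (simp add: c_def)
    qed simp
    have int1: "integrable P (\<lambda>\<psi>. c \<eta> \<psi> * indicator (cyl E U \<eta>) \<psi>)"
      by (rule integrable_const_bound[of _ 1]) (use c1[of \<eta>] in \<open>eventually_elim, auto simp: indicator_def\<close>, measurable)
    have int2: "integrable P (\<lambda>\<psi>. local_prob E \<mu> U \<eta> \<psi> * indicator (cyl E U \<eta>) \<psi>)"
      by (rule integrable_cong_AE_imp[OF int1 _ *]) measurable
    \<comment> \<open>The identity on the cylinder is now conditioned on the exterior. The factors
      \<open>c \<eta>\<close> and \<open>local_prob\<close> are measurable there and can be pulled
      out, while the indicator turns into a second factor \<open>c \<eta>\<close>.\<close>
    have "AE \<psi> in P. real_cond_exp P ?F (\<lambda>\<psi>. c \<eta> \<psi> * indicator (cyl E U \<eta>) \<psi>) \<psi>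
        = real_cond_exp P ?F (\<lambda>\<psi>. local_prob E \<mu> U \<eta> \<psi> * indicator (cyl E U \<eta>) \<psi>) \<psi>"
      using * by (rule real_cond_exp_cong) measurable
    moreover have "AE \<psi> in P. real_cond_exp P ?F (\<lambda>\<psi>. c \<eta> \<psi> * indicator (cyl E U \<eta>) \<psi>) \<psi> = c \<eta> \<psi> * c \<eta> \<psi>"
      using real_cond_exp_mult[OF cF _ int1] by (simp add: c_def)
    moreover have "AE \<psi> in P. real_cond_exp P ?F (\<lambda>\<psi>. local_prob E \<mu> U \<eta> \<psi> * indicator (cyl E U \<eta>) \<psi>) \<psi> = local_prob E \<mu> U \<eta> \<psi> * c \<eta> \<psi>"
      using real_cond_exp_mult[OF locF _ int2] by (simp add: c_def)
    ultimately show ?thesis by eventually_elim simp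
  qed
  then have "AE \<psi> in P. \<forall>\<eta>\<in>PiE U (\<lambda>_. UNIV). c \<eta> \<psi> * c \<eta> \<psi> = local_prob E \<mu> U \<eta> \<psi> * c \<eta> \<psi>"
    by (intro AE_finite_allI fP)
  moreover have "AE \<psi> in P. \<forall>\<eta>\<in>PiE U (\<lambda>_. UNIV). 0 \<le> c \<eta> \<psi>"
    by (intro AE_finite_allI fP c1)
  moreover have "AE \<psi> in P. (\<Sum>\<eta>\<in>PiE U (\<lambda>_. UNIV). c \<eta> \<psi>) = 1"
  proof -
    have one: "(\<Sum>\<eta>\<in>PiE U (\<lambda>_. UNIV). indicator (cyl E U \<eta>) \<psi>) = (1::real)" if "\<psi> \<in> space P" for \<psi>
    proof -
      have "(\<Sum>\<eta>\<in>PiE U (\<lambda>_. UNIV). indicator (cyl E U \<eta>) \<psi>) = (\<Sum>\<eta>\<in>{restrict \<psi> U}. indicator (cyl E U \<eta>) \<psi> :: real)"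
      proof (rule sum.mono_neutral_right[OF fP])
        show "\<forall>\<eta>\<in>PiE U (\<lambda>_. UNIV) - {restrict \<psi> U}. indicator (cyl E U \<eta>) \<psi> = (0::real)"
          by (auto simp: indicator_def cyl_def PiE_def extensional_def restrict_def fun_eq_iff)
      qed auto
      also have "\<dots> = 1" using that by (simp add: cyl_def sp)
      finally show ?thesis .
    qed
    have "AE \<psi> in P. real_cond_exp P ?F (\<lambda>\<psi>. \<Sum>\<eta>\<in>PiE U (\<lambda>_. UNIV). indicator (cyl E U \<eta>) \<psi>) \<psi> = (\<Sum>\<eta>\<in>PiE U (\<lambda>_. UNIV). c \<eta> \<psi>)"
      unfolding c_def by (rule real_cond_exp_sum) (rule ind)
    moreover have "AE \<psi> in P. real_cond_exp P ?F (\<lambda>\<psi>. \<Sum>\<eta>\<in>PiE U (\<lambda>_. UNIV). indicator (cyl E U \<eta>) \<psi>) \<psi> = real_cond_exp P ?F (\<lambda>_. 1) \<psi>"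
      using one by (intro real_cond_exp_cong AE_I2) (auto intro!: borel_measurable_sum)
    moreover have "AE \<psi> in P. real_cond_exp P ?F (\<lambda>_. 1) \<psi> = 1"
      by (rule real_cond_exp_F_meas) auto
    ultimately show ?thesis by eventually_elim simp
  qed
  ultimately have "AE \<psi> in P. c \<eta> \<psi> = local_prob E \<mu> U \<eta> \<psi>"
    using AE_space
  proof eventually_elim
    case (elim \<psi>)
    then have \<psi>: "\<psi> \<in> homs E" by (simp add: sp)
    have le: "c \<eta> \<psi> \<le> local_prob E \<mu> U \<eta> \<psi>" if "\<eta> \<in> PiE U (\<lambda>_. UNIV)" for \<eta>
      using elim(1,2) that local_prob_nonneg[where \<mu> = \<mu>, OF U \<mu> \<psi>, of \<eta>] by (cases "c \<eta> \<psi> = 0") auto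
    have "(\<Sum>\<eta>\<in>PiE U (\<lambda>_. UNIV). local_prob E \<mu> U \<eta> \<psi> - c \<eta> \<psi>) = 0"
      using elim(3) sum_local_prob[where \<mu> = \<mu>, OF U \<mu> \<psi>] by (simp add: sum_subtractf)
    then have "\<forall>\<eta>\<in>PiE U (\<lambda>_. UNIV). local_prob E \<mu> U \<eta> \<psi> - c \<eta> \<psi> = 0"
      by (subst (asm) sum_nonneg_eq_0_iff[OF fP]) (use le in auto)
    then show "c \<eta> \<psi> = local_prob E \<mu> U \<eta> \<psi>" using \<eta> by auto
  qed
  then show ?thesis by (simp add: c_def)
qed

text \<open>The DLR equation, from integrating the conditional probability. Only the values of
  \<eta> on U matter on both sides, so \<eta> is first cut down to U.\<close>

lemma gibbs_cyl_integral:
  assumes E: "board E" and U: "finite U" and \<mu>: "\<And>c. 0 < \<mu> c" and P: "gibbs E \<mu> P"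
  shows "measure P (cyl E U \<eta>) = (\<integral>\<psi>. local_prob E \<mu> U \<eta> \<psi> \<partial>P)"
proof -
  interpret prob_space P using P by (simp add: gibbs_def)
  have sets: "sets P = sets (config_space E)" using P by (simp add: gibbs_def)
  let ?F = "outside_algebra E U" and ?\<eta> = "restrict \<eta> U"
  interpret finite_measure_subalgebra P ?F
    by unfold_locales (rule subalgebra_outside[OF sets])
  have cyl[measurable]: "cyl E U \<eta> \<in> sets P" for \<eta>
    unfolding sets sets_config_space using U by (rule cyl_in_coord_alg) simp
  have ind: "integrable P (indicator (cyl E U \<eta>) :: _ \<Rightarrow> real)" for \<eta>
    by (rule integrable_const_bound[of _ 1]) auto
  have "measure P (cyl E U \<eta>) = (\<integral>\<psi>. indicator (cyl E U ?\<eta>) \<psi> \<partial>P)"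
    by (simp add: cyl_restrict)
  also have "\<dots> = (\<integral>\<psi>. real_cond_exp P ?F (indicator (cyl E U ?\<eta>)) \<psi> \<partial>P)"
    by (rule real_cond_exp_int(2)[OF ind, symmetric])
  also have "\<dots> = (\<integral>\<psi>. local_prob E \<mu> U ?\<eta> \<psi> \<partial>P)"
    using local_prob_measurable_config[OF E U sets] gibbs_cond_exp[where \<mu> = \<mu>, OF E U \<mu> P, of ?\<eta>]
    by (intro integral_cong_AE) auto
  finally show ?thesis by (simp add: local_prob_restrict)
qed

section \<open>A criterion for being a Gibbs measure\<close>

lemma emeasure_density_real:
  fixes f :: "'a \<Rightarrow> real"
  assumes "integrable M f" "AE x in M. 0 \<le> f x" "B \<in> sets M"
  shows "emeasure (density M (\<lambda>x. ennreal (f x))) B = ennreal (\<integral>x. f x * indicator B x \<partial>M)"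
proof -
  have "emeasure (density M (\<lambda>x. ennreal (f x))) B = (\<integral>\<^sup>+x. ennreal (f x) * indicator B x \<partial>M)"
    using assms by (intro emeasure_density) auto
  also have "\<dots> = (\<integral>\<^sup>+x. ennreal (f x * indicator B x) \<partial>M)"
    by (intro nn_integral_cong) (auto simp: indicator_def)
  also have "\<dots> = ennreal (\<integral>x. f x * indicator B x \<partial>M)"
    using assms integrable_real_mult_indicator[OF assms(3,1)]
    by (intro nn_integral_eq_integral) (auto simp: indicator_def elim!: eventually_mono)
  finally show ?thesis .
qed

text \<open>If the probability of a large cylinder is the weight on U times a factor blind to U,
  then that factor cancels when conditioning on finitely many exterior coordinates, and what remains
  is the specification. An intersection-stable generator extends this to the whole exterior
  sigma-algebra. The bound \<open>N0\<close> lets the factorisation start only once the segment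
  contains U with its surroundings.\<close>

lemma gibbsI:
  assumes E: "board E" and \<mu>: "\<And>c. 0 < \<mu> c" and "prob_space P" and sets: "sets P = sets (config_space E)"
    and R: "\<And>U. finite U \<Longrightarrow> \<exists>N0. \<forall>N\<ge>N0. \<exists>R. (\<forall>\<phi> \<psi>. (\<forall>v. v \<notin> U \<longrightarrow> \<phi> v = \<psi> v) \<longrightarrow> R \<phi> = R \<psi>)
        \<and> (\<forall>\<psi>\<in>homs E. measure P (cyl E {..<N} \<psi>) = weight \<mu> U \<psi> * R \<psi>)"
  shows "gibbs E \<mu> P"
proof -
  interpret prob_space P by fact
  have sp: "space P = homs E" using sets_eq_imp_space_eq[OF sets] by (simp add: space_config_space)
  have cyl[measurable]: "cyl E U \<eta> \<in> sets P" if "finite U" for \<eta> U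
    unfolding sets sets_config_space using that by (rule cyl_in_coord_alg) simp
  have "AE \<psi> in P. real_cond_exp P (outside_algebra E U) (indicator {\<phi> \<in> space P. \<forall>v\<in>U. \<phi> v = \<psi> v}) \<psi> = spec_prob E \<mu> U \<psi>"
    if U: "finite U" for U
  proof -
    let ?F = "outside_algebra E U"
    interpret finite_measure_subalgebra P ?F
      by unfold_locales (rule subalgebra_outside[OF sets])
    have locP[measurable]: "local_prob E \<mu> U \<eta> \<in> borel_measurable P" for \<eta>
      by (rule local_prob_measurable_config) fact+
    have loc_bd: "0 \<le> local_prob E \<mu> U \<eta> \<psi>" "local_prob E \<mu> U \<eta> \<psi> \<le> 1" if "\<psi> \<in> homs E" for \<eta> \<psi>
      using local_prob_nonneg[where \<mu> = \<mu>, OF U \<mu> that] local_prob_le_1[where \<mu> = \<mu>, OF U \<mu> that] by auto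
    have intl: "integrable P (local_prob E \<mu> U \<eta>)" for \<eta>
      by (rule integrable_const_bound[of _ 1]) (auto simp: sp loc_bd)
    have inti: "integrable P (indicator (cyl E U \<eta>) :: _ \<Rightarrow> real)" for \<eta>
      using U by (intro integrable_const_bound[of _ 1]) auto
    obtain N0 where N0: "\<And>N. N0 \<le> N \<Longrightarrow> \<exists>R. (\<forall>\<phi> \<psi>. (\<forall>v. v \<notin> U \<longrightarrow> \<phi> v = \<psi> v) \<longrightarrow> R \<phi> = R \<psi>)
        \<and> (\<forall>\<psi>\<in>homs E. measure P (cyl E {..<N} \<psi>) = weight \<mu> U \<psi> * R \<psi>)"
      using R[OF U] by blast
    obtain n1 where n1: "U \<union> bdry E U \<subseteq> {..<n1}"
      using U finite_bdry[OF E U] finite_nat_set_iff_bounded[of "U \<union> bdry E U"] by auto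
    define n0 where "n0 = max N0 n1"
    have key: "measure P (cyl E ({..<n} \<inter> - U) \<psi> \<inter> cyl E U \<eta>) = local_prob E \<mu> U \<eta> \<psi> * measure P (cyl E ({..<n} \<inter> - U) \<psi>)"
      if n: "n0 \<le> n" and \<psi>: "\<psi> \<in> homs E" for n \<psi> \<eta>
    proof -
      have Un: "U \<subseteq> {..<n}" "bdry E U \<subseteq> {..<n}" using n1 n by (auto simp: n0_def)
      obtain r where r: "\<And>\<phi> \<psi>. (\<forall>v. v \<notin> U \<longrightarrow> \<phi> v = \<psi> v) \<Longrightarrow> r \<phi> = r \<psi>"
        "\<And>\<psi>. \<psi> \<in> homs E \<Longrightarrow> measure P (cyl E {..<n} \<psi>) = weight \<mu> U \<psi> * r \<psi>"
        using N0[of n] n by (auto simp: n0_def)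
      have sum: "measure P (\<Union>\<phi>\<in>S. cyl E {..<n} \<phi>) = (\<Sum>\<phi>\<in>S. weight \<mu> U \<phi>) * r \<psi>"
        if S: "S \<subseteq> fillings E U \<psi>" for S
      proof -
        have "disjoint_family_on (cyl E {..<n}) S"
        proof (unfold disjoint_family_on_def, intro ballI impI)
          fix \<phi> \<phi>' assume *: "\<phi> \<in> S" "\<phi>' \<in> S" "\<phi> \<noteq> \<phi>'"
          then obtain v where v: "\<phi> v \<noteq> \<phi>' v" by auto
          have "v \<in> U"
          proof (rule ccontr)
            assume "v \<notin> U"
            then have "\<phi> v = \<psi> v" "\<phi>' v = \<psi> v" using * S by (auto simp: fillings_def)
            then show False using v by simp
          qed
          then have "v \<in> {..<n}" using Un by auto
          then show "cyl E {..<n} \<phi> \<inter> cyl E {..<n} \<phi>' = {}" using v unfolding cyl_def by fastforce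
        qed
        then have "measure P (\<Union>\<phi>\<in>S. cyl E {..<n} \<phi>) = (\<Sum>\<phi>\<in>S. measure P (cyl E {..<n} \<phi>))"
          using finite_subset[OF S finite_fillings[OF U]] by (intro finite_measure_finite_Union) auto
        also have "\<dots> = (\<Sum>\<phi>\<in>S. weight \<mu> U \<phi> * r \<psi>)"
        proof (rule sum.cong[OF refl])
          fix \<phi> assume "\<phi> \<in> S"
          then have "\<phi> \<in> fillings E U \<psi>" using S by auto
          then have "\<phi> \<in> homs E" "r \<phi> = r \<psi>" by (auto simp: fillings_def intro: r(1))
          then show "measure P (cyl E {..<n} \<phi>) = weight \<mu> U \<phi> * r \<psi>" using r(2) by simp
        qed
        finally show ?thesis by (simp add: sum_distrib_right)
      qed
      \<comment> \<open>A member of the cylinder may differ from \<psi> beyond n, so it need not be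
        a filling itself. Transplanting its values on U into \<psi> gives one, as the neighbours of
        U lie below n.\<close>
      have fill: "override_on \<psi> \<theta> U \<in> fillings E U \<psi>" "\<theta> \<in> cyl E {..<n} (override_on \<psi> \<theta> U)"
        if \<theta>: "\<theta> \<in> cyl E ({..<n} \<inter> - U) \<psi>" for \<theta>
      proof -
        have eq: "\<theta> v = \<psi> v" if "v < n" "v \<notin> U" for v using \<theta> that by (auto simp: cyl_def)
        have "override_on \<psi> \<theta> U \<in> homs E"
        proof (rule homs_boardI[OF E \<psi>, of U])
          fix u w assume uw: "u \<in> U" "E u w"
          then have "w \<in> U \<or> w \<in> bdry E U" by (auto simp: bdry_def)
          then have "override_on \<psi> \<theta> U w = \<theta> w" using eq[of w] Un by (auto simp: override_on_def)
          then show "hinge_adj (override_on \<psi> \<theta> U u) (override_on \<psi> \<theta> U w)"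
            using \<theta> uw by (simp add: cyl_def homs_def)
        qed simp
        then show "override_on \<psi> \<theta> U \<in> fillings E U \<psi>" by (simp add: fillings_def)
        show "\<theta> \<in> cyl E {..<n} (override_on \<psi> \<theta> U)"
          using \<theta> eq by (auto simp: cyl_def override_on_def)
      qed
      have sub: "cyl E {..<n} \<phi> \<subseteq> cyl E ({..<n} \<inter> - U) \<psi>" if "\<phi> \<in> fillings E U \<psi>" for \<phi>
        using that by (auto simp: cyl_def fillings_def)
      have "cyl E ({..<n} \<inter> - U) \<psi> = (\<Union>\<phi>\<in>fillings E U \<psi>. cyl E {..<n} \<phi>)"
        using fill sub by blast
      then have 1: "measure P (cyl E ({..<n} \<inter> - U) \<psi>) = pfun E \<mu> U \<psi> * r \<psi>"
        using sum[OF subset_refl] by (simp add: pfun_def)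
      have "cyl E ({..<n} \<inter> - U) \<psi> \<inter> cyl E U \<eta> = (\<Union>\<phi>\<in>{\<phi> \<in> fillings E U \<psi>. \<forall>v\<in>U. \<phi> v = \<eta> v}. cyl E {..<n} \<phi>)"
      proof (intro set_eqI iffI)
        fix \<theta> assume \<theta>: "\<theta> \<in> cyl E ({..<n} \<inter> - U) \<psi> \<inter> cyl E U \<eta>"
        then have "\<forall>v\<in>U. override_on \<psi> \<theta> U v = \<eta> v" by (auto simp: cyl_def)
        then show "\<theta> \<in> (\<Union>\<phi>\<in>{\<phi> \<in> fillings E U \<psi>. \<forall>v\<in>U. \<phi> v = \<eta> v}. cyl E {..<n} \<phi>)"
          using fill \<theta> by blast
      next
        fix \<theta> assume "\<theta> \<in> (\<Union>\<phi>\<in>{\<phi> \<in> fillings E U \<psi>. \<forall>v\<in>U. \<phi> v = \<eta> v}. cyl E {..<n} \<phi>)"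
        then obtain \<phi> where \<phi>: "\<phi> \<in> fillings E U \<psi>" "\<forall>v\<in>U. \<phi> v = \<eta> v" "\<theta> \<in> cyl E {..<n} \<phi>" by blast
        then have "\<forall>v\<in>U. \<theta> v = \<eta> v" using Un by (auto simp: cyl_def)
        then have "\<theta> \<in> cyl E U \<eta>" using \<phi>(3) by (simp add: cyl_def)
        then show "\<theta> \<in> cyl E ({..<n} \<inter> - U) \<psi> \<inter> cyl E U \<eta>"
          using \<phi>(3) sub[OF \<phi>(1)] by blast
      qed
      then have 2: "measure P (cyl E ({..<n} \<inter> - U) \<psi> \<inter> cyl E U \<eta>)
          = (\<Sum>\<phi>\<in>{\<phi> \<in> fillings E U \<psi>. \<forall>v\<in>U. \<phi> v = \<eta> v}. weight \<mu> U \<phi>) * r \<psi>"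
        using sum[of "{\<phi> \<in> fillings E U \<psi>. \<forall>v\<in>U. \<phi> v = \<eta> v}"] by auto
      show ?thesis unfolding 1 2 local_prob_def using pfun_pos[where \<mu> = \<mu>, OF U \<mu> \<psi>] by simp
    qed
    have ae: "AE \<psi> in P. real_cond_exp P ?F (indicator (cyl E U \<eta>)) \<psi> = local_prob E \<mu> U \<eta> \<psi>" for \<eta>
    proof (rule real_cond_exp_charact)
      \<comment> \<open>\<open>M f\<close> is the measure with density f, restricted to exterior
        events. The conditional expectation is characterised by its integrals over such events, so
        it suffices that two finite measures agree on exterior cylinders.\<close>
      define M where "M f = restr_to_subalg (density P (\<lambda>\<psi>. ennreal (f \<psi>))) ?F" for f :: "(nat \<Rightarrow> color) \<Rightarrow> real"
      have subM: "subalgebra (density P (\<lambda>\<psi>. ennreal (f \<psi>))) ?F" for f :: "(nat \<Rightarrow> color) \<Rightarrow> real"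
        using subalg by (simp add: subalgebra_def)
      have setsM: "sets (M f) = sets ?F" for f unfolding M_def by (rule sets_restr_to_subalg[OF subM])
      have BP: "B \<in> sets P" if "B \<in> sets ?F" for B using subalg that by (auto simp: subalgebra_def)
      have emM: "emeasure (M f) B = ennreal (\<integral>\<psi>. f \<psi> * indicator B \<psi> \<partial>P)"
        if "integrable P f" "\<And>\<psi>. \<psi> \<in> homs E \<Longrightarrow> 0 \<le> f \<psi>" "B \<in> sets ?F" for f B
        unfolding M_def emeasure_restr_to_subalg[OF subM that(3)]
        using that BP by (intro emeasure_density_real AE_I2) (auto simp: sp)
      have iB: "emeasure (M (indicator (cyl E U \<eta>))) B = ennreal (\<integral>\<psi>. indicator (cyl E U \<eta>) \<psi> * indicator B \<psi> \<partial>P)"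
        "emeasure (M (local_prob E \<mu> U \<eta>)) B = ennreal (\<integral>\<psi>. local_prob E \<mu> U \<eta> \<psi> * indicator B \<psi> \<partial>P)"
        if "B \<in> sets ?F" for B
        using that loc_bd by (intro emM inti intl; simp)+
      have F: "sets ?F = sigma_sets (homs E) (cyl_basis E (- U) n0)"
        unfolding outside_algebra_eq by (rule sigma_sets_cyl_basis)
      have eq: "M (indicator (cyl E U \<eta>)) = M (local_prob E \<mu> U \<eta>)"
      proof (rule measure_eqI_generator_eq_countable[OF Int_stable_cyl_basis cyl_basis_subset])
        fix X assume X: "X \<in> cyl_basis E (- U) n0"
        then have XF: "X \<in> sets ?F" unfolding F by (rule sigma_sets.Basic)
        have "(\<integral>\<psi>. indicator (cyl E U \<eta>) \<psi> * indicator X \<psi> \<partial>P) = (\<integral>\<psi>. local_prob E \<mu> U \<eta> \<psi> * indicator X \<psi> \<partial>P)"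
        proof (cases "X = {}")
          case False
          then obtain \<psi> n \<xi> where \<psi>: "\<psi> \<in> X" and *: "X = cyl E ({..<n} \<inter> - U) \<xi>" "n0 \<le> n"
            using X unfolding cyl_basis_def by blast
          have \<psi>h: "\<psi> \<in> homs E" using \<psi> by (simp add: * cyl_def)
          have X\<psi>: "X = cyl E ({..<n} \<inter> - U) \<psi>" using \<psi> unfolding * by (auto simp: cyl_def)
          have bn: "bdry E U \<subseteq> {..<n} \<inter> - U" using n1 \<open>n0 \<le> n\<close> by (auto simp: n0_def bdry_def)
          have "local_prob E \<mu> U \<eta> \<phi> = local_prob E \<mu> U \<eta> \<psi>" if "\<phi> \<in> X" for \<phi>
            using that bn by (intro local_prob_cong E \<psi>h) (auto simp: X\<psi> cyl_def)
          then have "(\<integral>\<phi>. local_prob E \<mu> U \<eta> \<phi> * indicator X \<phi> \<partial>P) = (\<integral>\<phi>. local_prob E \<mu> U \<eta> \<psi> * indicator X \<phi> \<partial>P)"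
            by (intro Bochner_Integration.integral_cong) (auto simp: indicator_def)
          also have "\<dots> = local_prob E \<mu> U \<eta> \<psi> * measure P X" using BP[OF XF] by simp
          also have "\<dots> = measure P (X \<inter> cyl E U \<eta>)" unfolding X\<psi> using key[OF \<open>n0 \<le> n\<close> \<psi>h] by simp
          also have "\<dots> = (\<integral>\<phi>. indicator (X \<inter> cyl E U \<eta>) \<phi> \<partial>P)" using BP[OF XF] cyl[OF U] by simp
          also have "\<dots> = (\<integral>\<phi>. indicator (cyl E U \<eta>) \<phi> * indicator X \<phi> \<partial>P)"
            by (intro Bochner_Integration.integral_cong) (auto simp: indicator_def)
          finally show ?thesis by simp
        qed simp
        then show "emeasure (M (indicator (cyl E U \<eta>))) X = emeasure (M (local_prob E \<mu> U \<eta>)) X"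
          by (simp only: iB[OF XF])
      next
        let ?C = "(\<lambda>\<xi>. cyl E ({..<n0} \<inter> - U) \<xi>) ` (\<lambda>\<phi>. restrict \<phi> ({..<n0} \<inter> - U)) ` homs E"
        show C: "?C \<subseteq> cyl_basis E (- U) n0" by (auto simp: cyl_basis_def)
        show "countable ?C" by (intro countable_finite finite_imageI finite_restrict_range) simp
        show "\<Union> ?C = homs E" by (rule local_event_eq[symmetric]) auto
        fix a assume "a \<in> ?C"
        then have "a \<in> sets ?F" unfolding F using C by (auto intro!: sigma_sets.Basic)
        then show "emeasure (M (indicator (cyl E U \<eta>))) a \<noteq> \<infinity>" by (simp add: iB)
      qed (simp_all only: setsM F)
      fix B assume B: "B \<in> sets ?F"
      have "ennreal (\<integral>\<psi>. indicator (cyl E U \<eta>) \<psi> * indicator B \<psi> \<partial>P) = ennreal (\<integral>\<psi>. local_prob E \<mu> U \<eta> \<psi> * indicator B \<psi> \<partial>P)"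
        using iB[OF B] by (simp add: eq)
      moreover have "0 \<le> (\<integral>\<psi>. local_prob E \<mu> U \<eta> \<psi> * indicator B \<psi> \<partial>P)"
        by (intro integral_nonneg_AE AE_I2) (auto simp: sp loc_bd)
      moreover have "0 \<le> (\<integral>\<psi>. indicator (cyl E U \<eta>) \<psi> * indicator B \<psi> \<partial>P :: real)"
        by (intro integral_nonneg_AE AE_I2) auto
      ultimately have "(\<integral>\<psi>. indicator (cyl E U \<eta>) \<psi> * indicator B \<psi> \<partial>P) = (\<integral>\<psi>. local_prob E \<mu> U \<eta> \<psi> * indicator B \<psi> \<partial>P)"
        by (simp only: ennreal_inj)
      then show "(LINT \<psi>:B|P. indicator (cyl E U \<eta>) \<psi>) = (LINT \<psi>:B|P. local_prob E \<mu> U \<eta> \<psi>)"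
        unfolding set_lebesgue_integral_def by (simp add: mult.commute)
    next
      show "local_prob E \<mu> U \<eta> \<in> borel_measurable ?F"
        unfolding outside_algebra_eq by (rule local_prob_measurable) fact+
    qed (rule inti intl)+
    \<comment> \<open>The pattern in the definition of \<open>gibbs\<close> is that of \<psi> itself
      and varies with \<psi>. Uniting the null sets of the finitely many patterns makes the
      substitution legitimate.\<close>
    have "AE \<psi> in P. \<forall>\<eta>\<in>PiE U (\<lambda>_. UNIV). real_cond_exp P ?F (indicator (cyl E U \<eta>)) \<psi> = local_prob E \<mu> U \<eta> \<psi>"
      using U by (intro AE_finite_allI ae finite_PiE) simp_all
    then show ?thesis using AE_space
    proof eventually_elim
      case (elim \<psi>)
      then have \<psi>: "\<psi> \<in> homs E" by (simp add: sp)
      have "{\<phi> \<in> space P. \<forall>v\<in>U. \<phi> v = \<psi> v} = cyl E U (restrict \<psi> U)" by (auto simp: cyl_def sp)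
      moreover have "local_prob E \<mu> U (restrict \<psi> U) \<psi> = spec_prob E \<mu> U \<psi>"
        using spec_prob_eq[where \<mu> = \<mu>, OF E U \<mu> \<psi>] local_prob_self[OF \<psi>, of U "restrict \<psi> U" \<mu>] by simp
      ultimately show ?case using elim(1) by simp
    qed
  qed
  then show ?thesis using sets prob_space_axioms by (simp add: gibbs_def)
qed

section \<open>Message passing on trees\<close>

text \<open>The factor that a subtree with root weights g contributes to a parent of color
  c.\<close>

definition nbr_mass :: "(color \<Rightarrow> real) \<Rightarrow> color \<Rightarrow> real" where
  "nbr_mass g c = (\<Sum>d | hinge_adj c d. g d)"

lemma nbr_mass_simps:
  "nbr_mass g Green = g Green + g Yellow"
  "nbr_mass g Yellow = g Green + g Yellow + g Red"
  "nbr_mass g Red = g Yellow + g Red"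
proof -
  have "{d. hinge_adj Green d} = {Green, Yellow}" "{d. hinge_adj Yellow d} = {Green, Yellow, Red}"
    "{d. hinge_adj Red d} = {Yellow, Red}"
    using UNIV_color by (auto simp: hinge_adj_def)
  then show "nbr_mass g Green = g Green + g Yellow" "nbr_mass g Yellow = g Green + g Yellow + g Red"
    "nbr_mass g Red = g Yellow + g Red"
    by (simp_all add: nbr_mass_def)
qed

lemma hinge_adj_commute: "hinge_adj c d \<longleftrightarrow> hinge_adj d c"
  by (auto simp: hinge_adj_def)

text \<open>Parents are numbered before their children, so every nonempty initial segment
  \<open>{..<n}\<close> is a subtree containing the root, and its last vertex, unless it is the
  root, is a leaf of it. Exhausting the board by such segments replaces any use of balls or
  generations.\<close>

locale tree_model =
  fixes p :: "nat \<Rightarrow> nat" and \<mu> :: "color \<Rightarrow> real"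
  assumes parent_less: "0 < n \<Longrightarrow> p n < n"
    and finite_fibre: "finite {n. 0 < n \<and> p n = v}"
    and act_pos: "0 < \<mu> c"
begin

definition ch :: "nat \<Rightarrow> nat set" where
  "ch v = {n. 0 < n \<and> p n = v}"

definition edge :: "nat \<Rightarrow> nat \<Rightarrow> bool" where
  "edge v w \<longleftrightarrow> v \<in> ch w \<or> w \<in> ch v"

text \<open>The outer boundary of \<open>{..<n}\<close>: an edge leaving an initial segment always
  leads from a parent inside to a child outside.\<close>

definition front :: "nat \<Rightarrow> nat set" where
  "front n = {w. 0 < w \<and> n \<le> w \<and> p w < n}"

definition ok :: "nat \<Rightarrow> (nat \<Rightarrow> color) \<Rightarrow> bool" where
  "ok n \<xi> \<longleftrightarrow> (\<forall>w. 0 < w \<and> w < n \<longrightarrow> hinge_adj (\<xi> (p w)) (\<xi> w))"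

lemma finite_ch: "finite (ch v)"
  using finite_fibre by (simp add: ch_def)

lemma ch_greater: "y \<in> ch w \<Longrightarrow> w < y"
  using parent_less by (auto simp: ch_def)

lemma board_edge: "board edge"
proof -
  have "{w. edge v w} \<subseteq> insert (p v) (ch v)" for v by (auto simp: edge_def ch_def)
  then have "finite {w. edge v w}" for v using finite_ch finite_subset by blast
  then show ?thesis using ch_greater by (auto simp: board_def edge_def)
qed

lemma homs_edge_iff: "\<phi> \<in> homs edge \<longleftrightarrow> (\<forall>w>0. hinge_adj (\<phi> (p w)) (\<phi> w))"
  using hinge_adj_commute by (auto simp: homs_def edge_def ch_def)

lemma finite_front: "finite (front n)"
proof (rule finite_subset)
  show "front n \<subseteq> (\<Union>v<n. ch v)" by (auto simp: front_def ch_def)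
qed (simp add: finite_ch)

lemma front_Suc:
  assumes "0 < n"
  shows "front (Suc n) = (front n - {n}) \<union> ch n" "(front n - {n}) \<inter> ch n = {}" "n \<in> front n"
  using parent_less assms by (auto simp: front_def ch_def less_Suc_eq Suc_le_eq)

text \<open>The unnormalised partition function of the part of the subtree at w below N, given color
  c at w. Vertices from N on are frozen to the boundary condition \<psi> and send point
  masses.\<close>

function msg :: "nat \<Rightarrow> (nat \<Rightarrow> color) \<Rightarrow> nat \<Rightarrow> color \<Rightarrow> real" where
  "msg N \<psi> w c = (if N \<le> w then (if c = \<psi> w then 1 else 0)
     else \<mu> c * (\<Prod>y\<in>ch w. \<Sum>d | hinge_adj c d. msg N \<psi> y d))"
  by pat_completeness auto
termination
  by (relation "Wellfounded.measure (\<lambda>(N, \<psi>, w, c). N - w)") (auto dest: ch_greater)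

declare msg.simps[simp del]

lemma msg_leaf: "N \<le> w \<Longrightarrow> msg N \<psi> w c = (if c = \<psi> w then 1 else 0)"
  by (simp add: msg.simps)

lemma msg_rec: "w < N \<Longrightarrow> msg N \<psi> w c = \<mu> c * (\<Prod>y\<in>ch w. nbr_mass (msg N \<psi> y) c)"
  by (subst msg.simps) (simp add: nbr_mass_def)

lemma nbr_mass_leaf: "N \<le> w \<Longrightarrow> nbr_mass (msg N \<psi> w) c = (if hinge_adj c (\<psi> w) then 1 else 0)"
  by (simp add: nbr_mass_def msg_leaf)

lemma msg_nonneg: "0 \<le> msg N \<psi> w c"
proof (induction N \<psi> w c rule: msg.induct)
  case (1 N \<psi> w c)
  show ?case
  proof (cases "N \<le> w")
    case False
    then show ?thesis using act_pos[of c] 1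
      by (subst msg.simps) (auto intro!: mult_nonneg_nonneg prod_nonneg sum_nonneg)
  qed (simp add: msg_leaf)
qed

text \<open>Frozen vertices can send weight zero to a green or a red parent, but yellow is
  compatible with every color. Hence all messages are normalised by their yellow entry.\<close>

lemma nbr_mass_msg_pos: "0 < nbr_mass (msg N \<psi> w) Yellow" and msg_pos: "w < N \<Longrightarrow> 0 < msg N \<psi> w Yellow"
proof -
  have *: "0 < nbr_mass (msg N \<psi> w) Yellow \<and> (w < N \<longrightarrow> 0 < msg N \<psi> w Yellow)"
  proof (induction "N - w" arbitrary: w rule: less_induct)
    case less
    show ?case
    proof (cases "N \<le> w")
      case True
      then show ?thesis by (simp add: nbr_mass_leaf hinge_adj_def)
    next
      case False
      then have "0 < nbr_mass (msg N \<psi> y) Yellow" if "y \<in> ch w" for y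
        using less[of y] ch_greater[OF that] by simp
      then have "0 < msg N \<psi> w Yellow"
        using False act_pos by (subst msg_rec) (auto intro!: mult_pos_pos prod_pos)
      moreover have "msg N \<psi> w Yellow \<le> nbr_mass (msg N \<psi> w) Yellow"
        using msg_nonneg by (simp add: nbr_mass_simps)
      ultimately show ?thesis by simp
    qed
  qed
  then show "0 < nbr_mass (msg N \<psi> w) Yellow" "w < N \<Longrightarrow> 0 < msg N \<psi> w Yellow" by auto
qed

text \<open>Summing out the vertices \<open>N - 1, \<dots>, n\<close> in this order, each one is a leaf of the
  remaining tree.\<close>

lemma elimination:
  assumes "\<psi> \<in> homs edge" "0 < n" "n \<le> N"
  shows "(\<Sum>\<phi>\<in>{\<phi> \<in> fillings edge {..<N} \<psi>. \<forall>v<n. \<phi> v = \<xi> v}. weight \<mu> {..<N} \<phi>)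
    = (if ok n \<xi> then weight \<mu> {..<n} \<xi> * (\<Prod>w\<in>front n. nbr_mass (msg N \<psi> w) (\<xi> (p w))) else 0)"
  using assms(3,2)
proof (induction arbitrary: \<xi> rule: inc_induct)
  case base
  define \<theta> where "\<theta> = override_on \<psi> \<xi> {..<N}"
  have \<theta>: "\<theta> v = (if v < N then \<xi> v else \<psi> v)" for v by (simp add: \<theta>_def override_on_def)
  have hom: "\<theta> \<in> homs edge \<longleftrightarrow> ok N \<xi> \<and> (\<forall>w\<in>front N. hinge_adj (\<xi> (p w)) (\<psi> w))"
  proof -
    have "hinge_adj (\<theta> (p w)) (\<theta> w) \<longleftrightarrow> (if w < N then hinge_adj (\<xi> (p w)) (\<xi> w)
        else if p w < N then hinge_adj (\<xi> (p w)) (\<psi> w) else True)" if "0 < w" for w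
      using parent_less[OF that] that assms(1) by (auto simp: \<theta> homs_edge_iff)
    then show ?thesis unfolding homs_edge_iff ok_def front_def by fastforce
  qed
  have set_eq: "{\<phi> \<in> fillings edge {..<N} \<psi>. \<forall>v<N. \<phi> v = \<xi> v} = (if \<theta> \<in> homs edge then {\<theta>} else {})"
  proof -
    have "\<phi> = \<theta>" if "\<phi> \<in> fillings edge {..<N} \<psi>" "\<forall>v<N. \<phi> v = \<xi> v" for \<phi>
    proof
      fix v show "\<phi> v = \<theta> v" using that by (cases "v < N") (auto simp: \<theta> fillings_def)
    qed
    moreover have "\<theta> \<in> fillings edge {..<N} \<psi>" "\<forall>v<N. \<theta> v = \<xi> v" if "\<theta> \<in> homs edge"
      using that by (auto simp: fillings_def \<theta>)
    moreover have "\<phi> \<in> homs edge" if "\<phi> \<in> fillings edge {..<N} \<psi>" for \<phi>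
      using that by (simp add: fillings_def)
    ultimately show ?thesis by (smt (verit, best) Collect_cong Collect_empty_eq singleton_conv)
  qed
  have "(\<Prod>w\<in>front N. nbr_mass (msg N \<psi> w) (\<xi> (p w)))
      = (\<Prod>w\<in>front N. if hinge_adj (\<xi> (p w)) (\<psi> w) then 1 else 0)"
    by (rule prod.cong) (auto simp: front_def nbr_mass_leaf)
  also have "\<dots> = (if \<forall>w\<in>front N. hinge_adj (\<xi> (p w)) (\<psi> w) then 1 else 0)"
    using finite_front by (auto intro: prod.neutral)
  finally have pr: "(\<Prod>w\<in>front N. nbr_mass (msg N \<psi> w) (\<xi> (p w)))
      = (if \<forall>w\<in>front N. hinge_adj (\<xi> (p w)) (\<psi> w) then 1 else 0)" .
  have "weight \<mu> {..<N} \<theta> = weight \<mu> {..<N} \<xi>"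
    unfolding weight_def by (rule prod.cong) (auto simp: \<theta>)
  then show ?case unfolding set_eq pr using hom by auto
next
  case (step n)
  have "0 < n" by fact
  have pn: "p n < n" using parent_less \<open>0 < n\<close> .
  let ?S = "\<lambda>n \<xi>. {\<phi> \<in> fillings edge {..<N} \<psi>. \<forall>v<n. \<phi> v = \<xi> v}"
  have fin: "finite (?S n \<xi>)" for n \<xi> using finite_fillings[of "{..<N}"] by simp
  have group: "{\<phi> \<in> ?S n \<xi>. \<phi> n = c} = ?S (Suc n) (\<xi>(n := c))" for c
    by (auto simp: less_Suc_eq)
  have "(\<Sum>\<phi>\<in>?S n \<xi>. weight \<mu> {..<N} \<phi>) = (\<Sum>c\<in>UNIV. \<Sum>\<phi>\<in>{\<phi> \<in> ?S n \<xi>. \<phi> n = c}. weight \<mu> {..<N} \<phi>)"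
    by (rule sum.group[symmetric]) (auto simp: fin)
  also have "\<dots> = (\<Sum>c\<in>UNIV. if ok (Suc n) (\<xi>(n := c)) then weight \<mu> {..<Suc n} (\<xi>(n := c)) *
      (\<Prod>w\<in>front (Suc n). nbr_mass (msg N \<psi> w) ((\<xi>(n := c)) (p w))) else 0)"
    unfolding group by (rule sum.cong[OF refl], rule step.IH) simp
  \<comment> \<open>Passing from \<open>front (Suc n)\<close> back to \<open>front n\<close> trades
    the children of n for n itself: their factors together with \<open>\<mu> c\<close> make up the
    message of n.\<close>
  also have "\<dots> = (\<Sum>c\<in>UNIV. if ok n \<xi> \<and> hinge_adj (\<xi> (p n)) c then
      weight \<mu> {..<n} \<xi> * (\<Prod>w\<in>front n - {n}. nbr_mass (msg N \<psi> w) (\<xi> (p w))) * msg N \<psi> n c else 0)"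
  proof (rule sum.cong[OF refl])
    fix c
    have ok: "ok (Suc n) (\<xi>(n := c)) \<longleftrightarrow> ok n \<xi> \<and> hinge_adj (\<xi> (p n)) c"
    proof -
      have "hinge_adj ((\<xi>(n := c)) (p w)) ((\<xi>(n := c)) w) \<longleftrightarrow> hinge_adj (\<xi> (p w)) (\<xi> w)" if "0 < w" "w < n" for w
        using parent_less[OF that(1)] that by simp
      then show ?thesis unfolding ok_def using pn \<open>0 < n\<close> by (auto simp: less_Suc_eq)
    qed
    have w: "weight \<mu> {..<Suc n} (\<xi>(n := c)) = weight \<mu> {..<n} \<xi> * \<mu> c"
      unfolding weight_def by (simp add: lessThan_Suc mult.commute)
    have "(\<Prod>w\<in>front (Suc n). nbr_mass (msg N \<psi> w) ((\<xi>(n := c)) (p w)))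
        = (\<Prod>w\<in>front n - {n}. nbr_mass (msg N \<psi> w) ((\<xi>(n := c)) (p w))) * (\<Prod>w\<in>ch n. nbr_mass (msg N \<psi> w) ((\<xi>(n := c)) (p w)))"
      unfolding front_Suc(1)[OF \<open>0 < n\<close>]
      by (rule prod.union_disjoint) (auto simp: finite_front finite_ch front_Suc(2)[OF \<open>0 < n\<close>])
    also have "(\<Prod>w\<in>front n - {n}. nbr_mass (msg N \<psi> w) ((\<xi>(n := c)) (p w))) = (\<Prod>w\<in>front n - {n}. nbr_mass (msg N \<psi> w) (\<xi> (p w)))"
      by (rule prod.cong) (auto simp: front_def)
    also have "(\<Prod>w\<in>ch n. nbr_mass (msg N \<psi> w) ((\<xi>(n := c)) (p w))) = (\<Prod>w\<in>ch n. nbr_mass (msg N \<psi> w) c)"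
      by (rule prod.cong) (auto simp: ch_def)
    finally show "(if ok (Suc n) (\<xi>(n := c)) then weight \<mu> {..<Suc n} (\<xi>(n := c)) *
        (\<Prod>w\<in>front (Suc n). nbr_mass (msg N \<psi> w) ((\<xi>(n := c)) (p w))) else 0)
      = (if ok n \<xi> \<and> hinge_adj (\<xi> (p n)) c then
        weight \<mu> {..<n} \<xi> * (\<Prod>w\<in>front n - {n}. nbr_mass (msg N \<psi> w) (\<xi> (p w))) * msg N \<psi> n c else 0)"
      unfolding ok w using step.hyps by (simp add: msg_rec mult_ac)
  qed
  also have "\<dots> = (if ok n \<xi> then weight \<mu> {..<n} \<xi> * (\<Prod>w\<in>front n - {n}. nbr_mass (msg N \<psi> w) (\<xi> (p w)))
      * nbr_mass (msg N \<psi> n) (\<xi> (p n)) else 0)"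
    by (auto simp: nbr_mass_def sum_distrib_left sum.If_cases)
  also have "\<dots> = (if ok n \<xi> then weight \<mu> {..<n} \<xi> * (\<Prod>w\<in>front n. nbr_mass (msg N \<psi> w) (\<xi> (p w))) else 0)"
    using prod.remove[OF finite_front front_Suc(3)[OF \<open>0 < n\<close>], of "\<lambda>w. nbr_mass (msg N \<psi> w) (\<xi> (p w))"]
    by (simp add: mult_ac)
  finally show ?case .
qed

end

section \<open>Uniqueness from convergent messages\<close>

context tree_model
begin

lemma sum_over_restrictions:
  assumes "n \<le> N"
  shows "pfun edge \<mu> {..<N} \<psi> = (\<Sum>\<zeta>\<in>PiE {..<n} (\<lambda>_. UNIV).
    \<Sum>\<phi>\<in>{\<phi> \<in> fillings edge {..<N} \<psi>. \<forall>v<n. \<phi> v = \<zeta> v}. weight \<mu> {..<N} \<phi>)"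
proof -
  have fP: "finite (PiE {..<n} (\<lambda>_. UNIV :: color set))" by (rule finite_PiE) simp_all
  have eq: "{\<phi> \<in> fillings edge {..<N} \<psi>. \<forall>v<n. \<phi> v = \<zeta> v}
      = {\<phi> \<in> fillings edge {..<N} \<psi>. restrict \<phi> {..<n} = \<zeta>}" if "\<zeta> \<in> PiE {..<n} (\<lambda>_. UNIV)" for \<zeta>
  proof -
    have "(\<forall>v<n. \<phi> v = \<zeta> v) \<longleftrightarrow> restrict \<phi> {..<n} = \<zeta>" for \<phi>
      using that by (auto simp: fun_eq_iff PiE_def extensional_def restrict_def)
    then show ?thesis by simp
  qed
  have "pfun edge \<mu> {..<N} \<psi> = (\<Sum>\<zeta>\<in>PiE {..<n} (\<lambda>_. UNIV).
    \<Sum>\<phi>\<in>{\<phi> \<in> fillings edge {..<N} \<psi>. restrict \<phi> {..<n} = \<zeta>}. weight \<mu> {..<N} \<phi>)"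
    unfolding pfun_def by (rule sum.group[symmetric]) (use fP finite_fillings[of "{..<N}"] in \<open>auto split: if_splits\<close>)
  also have "\<dots> = (\<Sum>\<zeta>\<in>PiE {..<n} (\<lambda>_. UNIV).
    \<Sum>\<phi>\<in>{\<phi> \<in> fillings edge {..<N} \<psi>. \<forall>v<n. \<phi> v = \<zeta> v}. weight \<mu> {..<N} \<phi>)"
    by (rule sum.cong[OF refl]) (simp only: eq)
  finally show ?thesis .
qed

text \<open>The weight of a pattern on \<open>{..<n}\<close> when the subtree hanging at each w in
  the front acts through \<open>q w\<close>. It is used both with the normalised messages and with
  their limits.\<close>

definition front_weight :: "(nat \<Rightarrow> color \<Rightarrow> real) \<Rightarrow> nat \<Rightarrow> (nat \<Rightarrow> color) \<Rightarrow> real" where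
  "front_weight q n \<xi> = (if ok n \<xi> then weight \<mu> {..<n} \<xi> * (\<Prod>w\<in>front n. q w (\<xi> (p w))) else 0)"

lemma filling_ratio:
  assumes "\<psi> \<in> homs edge" "0 < n" "n \<le> N"
  defines "r \<equiv> \<lambda>w c. nbr_mass (msg N \<psi> w) c / nbr_mass (msg N \<psi> w) Yellow"
  shows "(\<Sum>\<phi>\<in>{\<phi> \<in> fillings edge {..<N} \<psi>. \<forall>v<n. \<phi> v = \<xi> v}. weight \<mu> {..<N} \<phi>) / pfun edge \<mu> {..<N} \<psi>
    = front_weight r n \<xi> / (\<Sum>\<zeta>\<in>PiE {..<n} (\<lambda>_. UNIV). front_weight r n \<zeta>)"
proof -
  \<comment> \<open>The cost of normalising the messages by their yellow entries; it is the same for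
    all patterns and cancels in the quotient.\<close>
  define D where "D = (\<Prod>w\<in>front n. nbr_mass (msg N \<psi> w) Yellow)"
  have D: "D > 0" unfolding D_def by (intro prod_pos nbr_mass_msg_pos ballI)
  have e: "(\<Sum>\<phi>\<in>{\<phi> \<in> fillings edge {..<N} \<psi>. \<forall>v<n. \<phi> v = \<xi> v}. weight \<mu> {..<N} \<phi>) = D * front_weight r n \<xi>" for \<xi>
  proof -
    have "(\<Prod>w\<in>front n. r w (\<xi> (p w))) = (\<Prod>w\<in>front n. nbr_mass (msg N \<psi> w) (\<xi> (p w))) / D"
      unfolding r_def D_def by (rule prod_dividef)
    then show ?thesis
      unfolding elimination[OF assms(1-3)] front_weight_def using D by simp
  qed
  show ?thesis
    unfolding sum_over_restrictions[OF assms(3)] e sum_distrib_left[symmetric] using D by simp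
qed

text \<open>The DLR equation on \<open>{..<N + n}\<close> expresses the cylinder probability as an
  average over boundary conditions. As N grows, the integrand converges to a constant independent of
  the boundary condition, and it is bounded by 1, so dominated convergence leaves that
  constant.\<close>

lemma gibbs_cyl_limit:
  assumes P: "gibbs edge \<mu> P" and n: "0 < n"
    and conv: "\<And>\<psi> w c. \<psi> \<in> homs edge \<Longrightarrow> 0 < w \<Longrightarrow>
      (\<lambda>N. nbr_mass (msg N \<psi> w) c / nbr_mass (msg N \<psi> w) Yellow) \<longlonglongrightarrow> q w c"
  shows "measure P (cyl edge {..<n} \<xi>)
    = front_weight q n \<xi> / (\<Sum>\<zeta>\<in>PiE {..<n} (\<lambda>_. UNIV). front_weight q n \<zeta>)"
proof -
  interpret prob_space P using P by (simp add: gibbs_def)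
  have sets: "sets P = sets (config_space edge)" using P by (simp add: gibbs_def)
  have sp: "space P = homs edge" using sets_eq_imp_space_eq[OF sets] by (simp add: space_config_space)
  have cyl[measurable]: "cyl edge U \<eta> \<in> sets P" if "finite U" for \<eta> U
    unfolding sets sets_config_space using that by (rule cyl_in_coord_alg) simp
  have locP[measurable]: "local_prob edge \<mu> {..<N} \<eta> \<in> borel_measurable P" for N \<eta>
    by (rule local_prob_measurable_config[OF board_edge _ sets]) simp
  let ?r = "\<lambda>N \<psi> w c. nbr_mass (msg N \<psi> w) c / nbr_mass (msg N \<psi> w) Yellow"
  define A where "A = (\<Sum>\<zeta>\<in>PiE {..<n} (\<lambda>_. UNIV). front_weight q n \<zeta>)"
  define T where "T N = {\<eta> \<in> PiE {..<N} (\<lambda>_. UNIV :: color set). \<forall>v<n. \<eta> v = \<xi> v}" for N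
  define s where "s N \<psi> = (\<Sum>\<eta>\<in>T (N + n). local_prob edge \<mu> {..<N + n} \<eta> \<psi>)" for N \<psi>
  have fP: "finite (PiE {..<N} (\<lambda>_. UNIV :: color set))" for N :: nat by (rule finite_PiE) simp_all
  have fT: "finite (T N)" for N using fP by (simp add: T_def)
  have loc_bd: "0 \<le> local_prob edge \<mu> {..<N} \<eta> \<psi>" "local_prob edge \<mu> {..<N} \<eta> \<psi> \<le> 1" if "\<psi> \<in> homs edge" for N \<eta> \<psi>
    using local_prob_nonneg[where \<mu> = \<mu>, OF _ act_pos that] local_prob_le_1[where \<mu> = \<mu>, OF _ act_pos that] by auto
  have intl: "integrable P (local_prob edge \<mu> {..<N} \<eta>)" for N \<eta>
    by (rule integrable_const_bound[of _ 1]) (auto simp: sp loc_bd)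
  have s_eq: "s N \<psi> = front_weight (?r (N + n) \<psi>) n \<xi> / (\<Sum>\<zeta>\<in>PiE {..<n} (\<lambda>_. UNIV). front_weight (?r (N + n) \<psi>) n \<zeta>)"
    if \<psi>: "\<psi> \<in> homs edge" for N \<psi>
  proof -
    have "restrict \<phi> {..<N + n} \<in> T (N + n) \<longleftrightarrow> (\<forall>v<n. \<phi> v = \<xi> v)" for \<phi>
      by (auto simp: T_def)
    then have "s N \<psi> = (\<Sum>\<phi>\<in>{\<phi> \<in> fillings edge {..<N + n} \<psi>. \<forall>v<n. \<phi> v = \<xi> v}. weight \<mu> {..<N + n} \<phi>) / pfun edge \<mu> {..<N + n} \<psi>"
      unfolding s_def by (subst sum_local_prob_subset) (auto simp: T_def)
    then show ?thesis using filling_ratio[OF \<psi> n, of "N + n" \<xi>] by simp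
  qed
  have meas: "measure P (cyl edge {..<n} \<xi>) = (\<integral>\<psi>. s N \<psi> \<partial>P)" for N
  proof -
    have "cyl edge {..<n} \<xi> = (\<Union>\<eta>\<in>T (N + n). cyl edge {..<N + n} \<eta>)"
    proof (intro set_eqI iffI)
      fix \<phi> assume "\<phi> \<in> cyl edge {..<n} \<xi>"
      then have "restrict \<phi> {..<N + n} \<in> T (N + n)" "\<phi> \<in> cyl edge {..<N + n} (restrict \<phi> {..<N + n})"
        by (auto simp: T_def cyl_def)
      then show "\<phi> \<in> (\<Union>\<eta>\<in>T (N + n). cyl edge {..<N + n} \<eta>)" by blast
    qed (auto simp: T_def cyl_def)
    moreover have "disjoint_family_on (cyl edge {..<N + n}) (T (N + n))"
    proof (unfold disjoint_family_on_def, intro ballI impI)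
      fix \<eta> \<eta>' assume *: "\<eta> \<in> T (N + n)" "\<eta>' \<in> T (N + n)" "\<eta> \<noteq> \<eta>'"
      then obtain v where v: "\<eta> v \<noteq> \<eta>' v" by auto
      then have "v < N + n" using * by (auto simp: T_def PiE_def extensional_def)
      then show "cyl edge {..<N + n} \<eta> \<inter> cyl edge {..<N + n} \<eta>' = {}" using v unfolding cyl_def by fastforce
    qed
    ultimately have "measure P (cyl edge {..<n} \<xi>) = (\<Sum>\<eta>\<in>T (N + n). measure P (cyl edge {..<N + n} \<eta>))"
      using fT by (simp add: finite_measure_finite_Union image_subset_iff)
    also have "\<dots> = (\<Sum>\<eta>\<in>T (N + n). \<integral>\<psi>. local_prob edge \<mu> {..<N + n} \<eta> \<psi> \<partial>P)"
      by (intro sum.cong refl gibbs_cyl_integral[OF board_edge _ _ P] act_pos) simp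
    also have "\<dots> = (\<integral>\<psi>. s N \<psi> \<partial>P)"
      unfolding s_def by (rule Bochner_Integration.integral_sum[symmetric]) (rule intl)
    finally show ?thesis .
  qed
  \<comment> \<open>The limits are the same for every homomorphism, so the properties of q are read
    off from the all-yellow one.\<close>
  have q1: "q w Yellow = 1" if "0 < w" for w
  proof -
    have "(\<lambda>N. 1) \<longlonglongrightarrow> q w Yellow"
    proof (rule Lim_transform_eventually[OF conv[OF all_yellow_in_homs that]])
      show "\<forall>\<^sub>F N in sequentially. ?r N (\<lambda>_. Yellow) w Yellow = 1"
        using nbr_mass_msg_pos[of _ "\<lambda>_. Yellow" w] by (simp add: less_imp_neq[symmetric])
    qed
    then show ?thesis using LIMSEQ_unique tendsto_const by blast
  qed
  have q0: "0 \<le> q w c" if "0 < w" for w c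
    by (rule LIMSEQ_le_const[OF conv[OF all_yellow_in_homs that]])
       (auto intro!: exI[of _ 0] divide_nonneg_nonneg sum_nonneg msg_nonneg simp: nbr_mass_def)
  have fw0: "0 \<le> front_weight q n \<zeta>" for \<zeta>
    unfolding front_weight_def
    by (auto intro!: mult_nonneg_nonneg prod_nonneg q0 less_imp_le[OF weight_pos] act_pos simp: front_def)
  have A: "A > 0"
  proof -
    let ?y = "restrict (\<lambda>_. Yellow) {..<n}"
    have "ok n ?y" using parent_less unfolding ok_def by (auto simp: hinge_adj_def)
    moreover have "(\<Prod>w\<in>front n. q w (?y (p w))) = 1"
      by (rule prod.neutral) (auto simp: front_def q1)
    ultimately have "front_weight q n ?y > 0"
      by (simp add: front_weight_def weight_pos act_pos)
    then show ?thesis unfolding A_def by (intro sum_pos2[OF fP, of ?y] fw0) auto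
  qed
  have lim: "(\<lambda>N. s N \<psi>) \<longlonglongrightarrow> front_weight q n \<xi> / A" if \<psi>: "\<psi> \<in> homs edge" for \<psi>
  proof -
    have "(\<lambda>N. front_weight (?r (N + n) \<psi>) n \<zeta>) \<longlonglongrightarrow> front_weight q n \<zeta>" for \<zeta>
    proof (cases "ok n \<zeta>")
      case True
      have "(\<lambda>N. \<Prod>w\<in>front n. ?r (N + n) \<psi> w (\<zeta> (p w))) \<longlonglongrightarrow> (\<Prod>w\<in>front n. q w (\<zeta> (p w)))"
        by (intro tendsto_prod LIMSEQ_ignore_initial_segment conv \<psi>) (simp add: front_def)
      then show ?thesis using True by (simp add: front_weight_def tendsto_mult_left)
    qed (simp add: front_weight_def)
    then show ?thesis
      unfolding s_eq[OF \<psi>] A_def using A by (intro tendsto_divide tendsto_sum) (auto simp: A_def)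
  qed
  have "(\<lambda>N. \<integral>\<psi>. s N \<psi> \<partial>P) \<longlonglongrightarrow> (\<integral>\<psi>. front_weight q n \<xi> / A \<partial>P)"
  proof (rule integral_dominated_convergence[where w = "\<lambda>_. 1"])
    show "AE \<psi> in P. (\<lambda>N. s N \<psi>) \<longlonglongrightarrow> front_weight q n \<xi> / A"
      by (rule AE_I2) (simp add: sp lim)
    fix N
    show "AE \<psi> in P. norm (s N \<psi>) \<le> 1"
    proof (rule AE_I2)
      fix \<psi> assume "\<psi> \<in> space P"
      then have \<psi>: "\<psi> \<in> homs edge" by (simp add: sp)
      have "s N \<psi> \<le> (\<Sum>\<eta>\<in>PiE {..<N + n} (\<lambda>_. UNIV). local_prob edge \<mu> {..<N + n} \<eta> \<psi>)"
        unfolding s_def by (intro sum_mono2 fP loc_bd \<psi>) (auto simp: T_def)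
      also have "\<dots> = 1" by (intro sum_local_prob act_pos \<psi>) simp
      finally show "norm (s N \<psi>) \<le> 1"
        unfolding s_def using loc_bd(1)[OF \<psi>] by (simp add: sum_nonneg)
    qed
    show "s N \<in> borel_measurable P" unfolding s_def by measurable
  qed auto
  then have "(\<lambda>N::nat. measure P (cyl edge {..<n} \<xi>)) \<longlonglongrightarrow> front_weight q n \<xi> / A"
    unfolding meas[symmetric] by (simp add: prob_space)
  then show ?thesis using LIMSEQ_unique tendsto_const unfolding A_def by blast
qed

lemma gibbs_unique:
  assumes "gibbs edge \<mu> P" "gibbs edge \<mu> Q"
    and "\<And>\<psi> w c. \<psi> \<in> homs edge \<Longrightarrow> 0 < w \<Longrightarrow>
      (\<lambda>N. nbr_mass (msg N \<psi> w) c / nbr_mass (msg N \<psi> w) Yellow) \<longlonglongrightarrow> q w c"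
  shows "P = Q"
proof (rule measure_eq_by_cylinders[where ?n0.0 = 1])
  show "measure P (cyl edge {..<n} \<xi>) = measure Q (cyl edge {..<n} \<xi>)" if "1 \<le> n" for n \<xi>
    using gibbs_cyl_limit[OF assms(1) _ assms(3)] gibbs_cyl_limit[OF assms(2) _ assms(3)] that by simp
qed (use assms(1,2) in \<open>simp_all add: gibbs_def\<close>)

end

section \<open>Gibbs measures from boundary laws\<close>

context tree_model
begin

text \<open>The root gets a fictitious yellow parent, which restricts nothing; it then follows the
  same kernel as all other vertices.\<close>

definition pcol :: "(nat \<Rightarrow> color) \<Rightarrow> nat \<Rightarrow> color" where
  "pcol \<xi> w = (if w = 0 then Yellow else \<xi> (p w))"

text \<open>Replacing inadmissible colors by yellow makes the chain a homomorphism for every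
  \<omega> and not merely almost surely. The kernels give inadmissible colors no mass, so no
  distribution changes.\<close>

definition sel :: "color \<Rightarrow> color \<Rightarrow> color" where
  "sel c d = (if hinge_adj c d then d else Yellow)"

lemma hinge_adj_sel: "hinge_adj c (sel c d)"
  by (simp add: sel_def hinge_adj_def)

text \<open>The tree-indexed Markov chain as a function of independent random maps: the map at
  \<open>n\<close> sends the color of the parent to the color of \<open>n\<close>.\<close>

function chain :: "(nat \<Rightarrow> color \<Rightarrow> color) \<Rightarrow> nat \<Rightarrow> color" where
  "chain \<omega> n = (if n = 0 then sel Yellow (\<omega> 0 Yellow)
     else sel (chain \<omega> (p n)) (\<omega> n (chain \<omega> (p n))))"
  by pat_completeness auto
termination
  by (relation "Wellfounded.measure snd") (auto intro: parent_less)

declare chain.simps[simp del]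

lemma chain_eq: "chain \<omega> n = sel (pcol (chain \<omega>) n) (\<omega> n (pcol (chain \<omega>) n))"
  by (subst chain.simps) (simp add: pcol_def)

lemma chain_in_homs: "chain \<omega> \<in> homs edge"
  unfolding homs_edge_iff
proof (intro allI impI)
  fix w :: nat assume "0 < w"
  then show "hinge_adj (chain \<omega> (p w)) (chain \<omega> w)"
    using hinge_adj_sel by (subst chain_eq[of \<omega> w]) (simp add: pcol_def)
qed

text \<open>Once the chain agrees with \<xi> so far, the color of the parent is known. A cylinder
  event thus splits into conditions on single coordinates of \<omega>, and independence turns it
  into a product.\<close>

lemma chain_eq_iff:
  "(\<forall>w<N. chain \<omega> w = \<xi> w) \<longleftrightarrow> (\<forall>w<N. sel (pcol \<xi> w) (\<omega> w (pcol \<xi> w)) = \<xi> w)"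
proof (induction N)
  case (Suc N)
  have "sel (pcol (chain \<omega>) N) (\<omega> N (pcol (chain \<omega>) N)) = sel (pcol \<xi> N) (\<omega> N (pcol \<xi> N))"
    if "\<forall>w<N. chain \<omega> w = \<xi> w"
    using that parent_less[of N] by (simp add: pcol_def)
  then show ?case using Suc chain_eq[of \<omega> N] by (auto simp: less_Suc_eq)
qed simp

definition kern :: "(nat \<Rightarrow> color \<Rightarrow> real) \<Rightarrow> nat \<Rightarrow> color \<Rightarrow> color \<Rightarrow> real" where
  "kern g w c d = (if hinge_adj c d then g w d / nbr_mass (g w) c else 0)"

lemma nbr_mass_pos: "(\<And>c. 0 < g c) \<Longrightarrow> 0 < nbr_mass g c"
  by (cases c) (simp_all add: nbr_mass_simps add_pos_pos)

lemma kernel_pmf: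
  assumes "\<And>w c. 0 < g w c"
  shows "\<exists>K :: (color \<Rightarrow> color) pmf. \<forall>c d. measure (measure_pmf K) {f. sel c (f c) = d} = kern g w c d"
proof -
  have k0: "0 \<le> kern g w c d" for c d
    using assms nbr_mass_pos[of "g w" c] by (simp add: kern_def less_imp_le)
  have k1: "(\<Sum>d\<in>UNIV. kern g w c d) = 1" for c
  proof -
    have "(\<Sum>d\<in>UNIV. kern g w c d) = nbr_mass (g w) c / nbr_mass (g w) c"
      unfolding kern_def by (simp add: sum.If_cases nbr_mass_def flip: sum_divide_distrib)
    then show ?thesis using nbr_mass_pos[of "g w" c] assms by simp
  qed
  have kpmf: "pmf (embed_pmf (kern g w c)) d = kern g w c d" for c d
  proof (rule pmf_embed_pmf)
    show "(\<integral>\<^sup>+d. ennreal (kern g w c d) \<partial>count_space UNIV) = 1"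
      by (simp add: nn_integral_count_space_finite sum_ennreal k0 k1)
  qed (rule k0)
  \<comment> \<open>Only the law of \<open>f c\<close> for each single c matters; independent values
    form one convenient coupling.\<close>
  define K where "K = Pi_pmf UNIV Yellow (\<lambda>c. embed_pmf (kern g w c))"
  have "measure (measure_pmf K) {f. sel c (f c) = d} = kern g w c d" for c d
  proof -
    have "measure (measure_pmf K) {f. sel c (f c) = d} = measure (measure_pmf (map_pmf (\<lambda>f. f c) K)) {x. sel c x = d}"
      by (simp add: vimage_def)
    also have "map_pmf (\<lambda>f. f c) K = embed_pmf (kern g w c)"
      unfolding K_def by (subst Pi_pmf_component) auto
    also have "measure (measure_pmf (embed_pmf (kern g w c))) {x. sel c x = d}
        = (\<Sum>x | sel c x = d. kern g w c x)"
      by (simp add: measure_measure_pmf_finite kpmf)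
    \<comment> \<open>The colors sent to d by \<open>sel c\<close> differ from d itself only in
      inadmissible ones, where the kernel vanishes.\<close>
    also have "\<dots> = (\<Sum>x\<in>{d}. kern g w c x)"
    proof (rule sum.mono_neutral_cong)
      show "kern g w c x = 0" if "x \<in> {x. sel c x = d} - {d}" for x
        using that by (auto simp: sel_def kern_def split: if_splits)
      show "kern g w c x = 0" if "x \<in> {d} - {x. sel c x = d}" for x
        using that by (auto simp: sel_def kern_def split: if_splits)
    qed auto
    finally show ?thesis by simp
  qed
  then show ?thesis by blast
qed

lemma chain_measure_exists:
  assumes "\<And>w c. 0 < g w c"
  obtains P where "prob_space P" "sets P = sets (config_space edge)"
    "\<And>N \<xi>. measure P (cyl edge {..<N} \<xi>) = (\<Prod>w<N. kern g w (pcol \<xi> w) (\<xi> w))"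
proof -
  obtain K :: "nat \<Rightarrow> (color \<Rightarrow> color) pmf"
    where K: "\<And>w c d. measure (measure_pmf (K w)) {f. sel c (f c) = d} = kern g w c d"
    using kernel_pmf[of g, OF assms] by metis
  define M where "M = PiM UNIV (\<lambda>w. measure_pmf (K w))"
  interpret product_prob_space "\<lambda>w. measure_pmf (K w)" UNIV
    by unfold_locales
  interpret prob_space M unfolding M_def by (rule prob_space_PiM) (rule prob_space_measure_pmf)
  have spM: "space M = UNIV" by (simp add: M_def space_PiM)
  have pre: "chain -` cyl edge {..<N} \<xi> \<inter> space M
      = {\<omega> \<in> space M. \<forall>w\<in>{..<N}. \<omega> w \<in> {f. sel (pcol \<xi> w) (f (pcol \<xi> w)) = \<xi> w}}" for N \<xi>
    using chain_in_homs chain_eq_iff[of N _ \<xi>] by (auto simp: cyl_def)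
  have setsM: "{\<omega> \<in> space M. \<forall>w\<in>{..<N}. \<omega> w \<in> X w} \<in> sets M" for N :: nat and X
  proof (rule sets.sets_Collect_finite_All)
    show "{\<omega> \<in> space M. \<omega> w \<in> X w} \<in> sets M" for w
      unfolding M_def by measurable
  qed simp
  have meas: "chain \<in> measurable M (config_space edge)"
  proof (rule measurable_sigma_sets)
    show "sets (config_space edge) = sigma_sets (homs edge) (cyl_basis edge UNIV 0)"
      unfolding sets_config_space by (rule sigma_sets_cyl_basis)
    show "cyl_basis edge UNIV 0 \<subseteq> Pow (homs edge)" by (rule cyl_basis_subset)
    show "chain \<in> space M \<rightarrow> homs edge" using chain_in_homs by blast
    fix Y assume "Y \<in> cyl_basis edge UNIV 0"
    then have "Y = {} \<or> (\<exists>n \<xi>. Y = cyl edge {..<n} \<xi>)" by (auto simp: cyl_basis_def)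
    then show "chain -` Y \<inter> space M \<in> sets M"
    proof
      assume "\<exists>n \<xi>. Y = cyl edge {..<n} \<xi>"
      then obtain n \<xi> where "Y = cyl edge {..<n} \<xi>" by blast
      then show ?thesis by (simp only: pre setsM)
    qed simp
  qed
  define P where "P = distr M (config_space edge) chain"
  show ?thesis
  proof (rule that[of P])
    show "prob_space P" unfolding P_def by (rule prob_space_distr[OF meas])
    show "sets P = sets (config_space edge)" by (simp add: P_def)
    fix N \<xi>
    have "cyl edge {..<N} \<xi> \<in> sets (config_space edge)"
      unfolding sets_config_space by (rule cyl_in_coord_alg) auto
    then have "measure P (cyl edge {..<N} \<xi>) = measure M (chain -` cyl edge {..<N} \<xi> \<inter> space M)"
      unfolding P_def by (rule measure_distr[OF meas])
    also have "emeasure M (chain -` cyl edge {..<N} \<xi> \<inter> space M)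
        = (\<Prod>w<N. emeasure (measure_pmf (K w)) {f. sel (pcol \<xi> w) (f (pcol \<xi> w)) = \<xi> w})"
      unfolding pre unfolding M_def by (rule emeasure_PiM_Collect) auto
    then have "measure M (chain -` cyl edge {..<N} \<xi> \<inter> space M) = (\<Prod>w<N. kern g w (pcol \<xi> w) (\<xi> w))"
      by (simp add: measure_pmf.emeasure_eq_measure emeasure_eq_measure K prod_ennreal prod_nonneg flip: K)
    finally show "measure P (cyl edge {..<N} \<xi>) = (\<Prod>w<N. kern g w (pcol \<xi> w) (\<xi> w))" .
  qed
qed

text \<open>In the product of transition probabilities, the normalising factor of each vertex other
  than the root cancels against the factor that the law assigns to it at its parent. Only the root
  and the front survive, which is the factorisation asked for by \<open>gibbsI\<close>. Rescaling
  the law at a vertex leaves its kernel unchanged, whence the free constants \<kappa>.\<close>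

lemma boundary_law_gibbs:
  assumes g: "\<And>w c. 0 < g w c" and \<kappa>: "\<And>w. 0 < \<kappa> w"
    and law: "\<And>w c. g w c = \<kappa> w * \<mu> c * (\<Prod>y\<in>ch w. nbr_mass (g y) c)"
  obtains P where "gibbs edge \<mu> P"
    "\<And>c. measure P (cyl edge {..<1} (\<lambda>_. c)) = g 0 c / nbr_mass (g 0) Yellow"
proof -
  obtain P where P: "prob_space P" "sets P = sets (config_space edge)"
    and cylP: "\<And>N \<xi>. measure P (cyl edge {..<N} \<xi>) = (\<Prod>w<N. kern g w (pcol \<xi> w) (\<xi> w))"
    using chain_measure_exists[of g, OF g] by blast
  have m: "0 < nbr_mass (g w) c" for w c using g by (rule nbr_mass_pos)
  define R where "R N \<psi> = (\<Prod>w<N. \<kappa> w) * (\<Prod>y\<in>front N. nbr_mass (g y) (\<psi> (p y))) / nbr_mass (g 0) Yellow"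
    for N \<psi>
  have formula: "measure P (cyl edge {..<N} \<psi>) = weight \<mu> {..<N} \<psi> * R N \<psi>"
    if \<psi>: "\<psi> \<in> homs edge" and N: "0 < N" for N \<psi>
  proof -
    have adj: "hinge_adj (pcol \<psi> w) (\<psi> w)" for w
      using \<psi> by (auto simp: pcol_def homs_edge_iff) (simp add: hinge_adj_def)
    let ?m = "\<lambda>y. nbr_mass (g y) (pcol \<psi> y)"
    have "measure P (cyl edge {..<N} \<psi>) = (\<Prod>w<N. g w (\<psi> w)) / (\<Prod>w<N. ?m w)"
      unfolding cylP by (simp add: kern_def adj prod_dividef)
    also have "(\<Prod>w<N. g w (\<psi> w)) = (\<Prod>w<N. \<kappa> w) * weight \<mu> {..<N} \<psi> * (\<Prod>w<N. \<Prod>y\<in>ch w. nbr_mass (g y) (\<psi> w))"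
      by (subst law) (simp add: prod.distrib weight_def)
    also have "(\<Prod>w<N. \<Prod>y\<in>ch w. nbr_mass (g y) (\<psi> w)) = (\<Prod>w<N. \<Prod>y\<in>ch w. ?m y)"
      by (intro prod.cong refl) (auto simp: ch_def pcol_def)
    also have "\<dots> = (\<Prod>y\<in>(\<Union>w<N. ch w). ?m y)"
      by (rule prod.UNION_disjoint[symmetric]) (auto simp: finite_ch, auto simp: ch_def)
    \<comment> \<open>The telescoping: each vertex below N except the root, and each vertex of the
      front, is the child of exactly one vertex below N.\<close>
    also have "(\<Union>w<N. ch w) = ({..<N} - {0}) \<union> front N"
    proof (intro set_eqI iffI)
      fix y assume "y \<in> ({..<N} - {0}) \<union> front N"
      then have "0 < y \<and> p y < N" using parent_less[of y] by (auto simp: front_def)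
      then show "y \<in> (\<Union>w<N. ch w)" by (auto simp: ch_def)
    qed (auto simp: ch_def front_def)
    also have "(\<Prod>y\<in>({..<N} - {0}) \<union> front N. ?m y) = (\<Prod>y\<in>{..<N} - {0}. ?m y) * (\<Prod>y\<in>front N. ?m y)"
      by (rule prod.union_disjoint) (auto simp: finite_front, auto simp: front_def)
    also have "(\<Prod>y\<in>front N. ?m y) = (\<Prod>y\<in>front N. nbr_mass (g y) (\<psi> (p y)))"
      by (rule prod.cong) (auto simp: front_def pcol_def)
    also have "(\<Prod>w<N. ?m w) = nbr_mass (g 0) Yellow * (\<Prod>y\<in>{..<N} - {0}. ?m y)"
      using N by (subst prod.remove[of _ 0]) (auto simp: pcol_def)
    finally have eq: "measure P (cyl edge {..<N} \<psi>)
        = (\<Prod>w<N. \<kappa> w) * weight \<mu> {..<N} \<psi>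
          * ((\<Prod>y\<in>{..<N} - {0}. ?m y) * (\<Prod>y\<in>front N. nbr_mass (g y) (\<psi> (p y))))
          / (nbr_mass (g 0) Yellow * (\<Prod>y\<in>{..<N} - {0}. ?m y))" .
    have "(\<Prod>y\<in>{..<N} - {0}. ?m y) > 0" by (intro prod_pos ballI m)
    moreover have "K * W * (D * F) / (m * D) = W * (K * F / m)" if "0 < D" for K W D F m :: real
      using that by simp
    ultimately show ?thesis unfolding eq R_def by blast
  qed
  have "gibbs edge \<mu> P"
  proof (rule gibbsI[OF board_edge act_pos P])
    fix U :: "nat set" assume U: "finite U"
    \<comment> \<open>Beyond all children of U the front hangs only at vertices outside U, so the
      surviving factors do not see U. Including 0 ensures that the segment is nonempty.\<close>
    have "finite (insert 0 U \<union> (\<Union>u\<in>U. ch u))" using U by (simp add: finite_ch)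
    then obtain N0 where N0: "insert 0 U \<union> (\<Union>u\<in>U. ch u) \<subseteq> {..<N0}"
      by (auto simp: finite_nat_set_iff_bounded)
    show "\<exists>N0. \<forall>N\<ge>N0. \<exists>R. (\<forall>\<phi> \<psi>. (\<forall>v. v \<notin> U \<longrightarrow> \<phi> v = \<psi> v) \<longrightarrow> R \<phi> = R \<psi>)
        \<and> (\<forall>\<psi>\<in>homs edge. measure P (cyl edge {..<N} \<psi>) = weight \<mu> U \<psi> * R \<psi>)"
    proof (intro exI[of _ N0] allI impI)
      fix N assume "N0 \<le> N"
      then have "insert 0 U \<union> (\<Union>u\<in>U. ch u) \<subseteq> {..<N}" using N0 by auto
      then have UN: "U \<subseteq> {..<N}" and "0 < N" and chN: "\<And>u y. u \<in> U \<Longrightarrow> y \<in> ch u \<Longrightarrow> y < N"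
        by blast+
      show "\<exists>R. (\<forall>\<phi> \<psi>. (\<forall>v. v \<notin> U \<longrightarrow> \<phi> v = \<psi> v) \<longrightarrow> R \<phi> = R \<psi>)
        \<and> (\<forall>\<psi>\<in>homs edge. measure P (cyl edge {..<N} \<psi>) = weight \<mu> U \<psi> * R \<psi>)"
      proof (intro exI[of _ "\<lambda>\<psi>. weight \<mu> ({..<N} - U) \<psi> * R N \<psi>"] conjI allI impI ballI)
        fix \<phi> \<psi> :: "nat \<Rightarrow> color" assume eq: "\<forall>v. v \<notin> U \<longrightarrow> \<phi> v = \<psi> v"
        have "weight \<mu> ({..<N} - U) \<phi> = weight \<mu> ({..<N} - U) \<psi>"
          unfolding weight_def by (rule prod.cong) (auto simp: eq)
        moreover have "(\<Prod>y\<in>front N. nbr_mass (g y) (\<phi> (p y))) = (\<Prod>y\<in>front N. nbr_mass (g y) (\<psi> (p y)))"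
        proof (rule prod.cong[OF refl])
          fix y assume y: "y \<in> front N"
          then have "p y \<notin> U" using chN[of "p y" y] by (auto simp: front_def ch_def)
          then show "nbr_mass (g y) (\<phi> (p y)) = nbr_mass (g y) (\<psi> (p y))" using eq by simp
        qed
        ultimately show "weight \<mu> ({..<N} - U) \<phi> * R N \<phi> = weight \<mu> ({..<N} - U) \<psi> * R N \<psi>"
          by (simp add: R_def)
      next
        fix \<psi> assume "\<psi> \<in> homs edge"
        moreover have "weight \<mu> {..<N} \<psi> = weight \<mu> U \<psi> * weight \<mu> ({..<N} - U) \<psi>"
          unfolding weight_def using prod.subset_diff[OF UN] by (simp add: mult.commute)
        ultimately show "measure P (cyl edge {..<N} \<psi>) = weight \<mu> U \<psi> * (weight \<mu> ({..<N} - U) \<psi> * R N \<psi>)"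
          using formula \<open>0 < N\<close> by simp
      qed
    qed
  qed
  moreover have "measure P (cyl edge {..<1} (\<lambda>_. c)) = g 0 c / nbr_mass (g 0) Yellow" for c
    unfolding cylP by (simp add: kern_def pcol_def hinge_adj_def)
  ultimately show ?thesis using that by blast
qed

end

section \<open>The recursion on the regular tree\<close>

definition gsum :: "nat \<Rightarrow> real \<Rightarrow> real" where
  "gsum k w = (\<Sum>i<k. w ^ i)"

lemma gsum_Suc: "gsum (Suc k) w = gsum k w + w ^ k"
  by (simp add: gsum_def)

lemma gsum_0: "gsum 0 w = 0"
  by (simp add: gsum_def)

lemma gsum_Suc': "gsum (Suc k) w = 1 + w * gsum k w"
proof (induction k)
  case (Suc k)
  have "gsum (Suc (Suc k)) w = gsum (Suc k) w + w * w ^ k" by (simp add: gsum_Suc)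
  also have "\<dots> = 1 + w * (gsum k w + w ^ k)" unfolding Suc by (simp add: algebra_simps)
  finally show ?case by (simp add: gsum_Suc)
qed (simp add: gsum_Suc gsum_0)

lemma gsum_pos: "0 < w \<Longrightarrow> 0 < k \<Longrightarrow> 0 < gsum k w"
  unfolding gsum_def by (rule sum_pos) auto

lemma gsum_geometric: "gsum k w * (w - 1) = w ^ k - 1"
  by (induction k) (simp_all add: gsum_Suc gsum_0 algebra_simps)

lemma gsum_one: "gsum k 1 = real k"
  by (simp add: gsum_def)

lemma gsum_upper: "1 \<le> w \<Longrightarrow> gsum (Suc k) w \<le> real (Suc k) * w ^ k"
  unfolding gsum_def using sum_bounded_above[of "{..<Suc k}" "\<lambda>i. w ^ i" "w ^ k"]
  by (simp add: power_increasing)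

text \<open>Cauchy-Schwarz applied to the powers in increasing and in decreasing order: each product
  of partners has the constant exponent k.\<close>

lemma gsum_square_ge:
  assumes "0 < w"
  shows "(real (Suc k))\<^sup>2 * w ^ k \<le> (gsum (Suc k) w)\<^sup>2"
proof -
  have "(\<Sum>i<Suc k. sqrt (w ^ i) * sqrt (w ^ (k - i)))\<^sup>2
      \<le> (\<Sum>i<Suc k. (sqrt (w ^ i))\<^sup>2) * (\<Sum>i<Suc k. (sqrt (w ^ (k - i)))\<^sup>2)"
    by (rule Cauchy_Schwarz_ineq_sum)
  also have "(\<Sum>i<Suc k. (sqrt (w ^ (k - i)))\<^sup>2) = (\<Sum>i<Suc k. w ^ (Suc k - Suc i))"
    using assms by (intro sum.cong) auto
  also have "\<dots> = gsum (Suc k) w"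
    unfolding gsum_def by (rule sum.nat_diff_reindex)
  also have "(\<Sum>i<Suc k. (sqrt (w ^ i))\<^sup>2) = gsum (Suc k) w"
    unfolding gsum_def using assms by (intro sum.cong) auto
  also have "(\<Sum>i<Suc k. sqrt (w ^ i) * sqrt (w ^ (k - i))) = (\<Sum>i<Suc k. sqrt (w ^ k))"
    by (intro sum.cong) (auto simp flip: real_sqrt_mult power_add)
  finally have "(real (Suc k) * sqrt (w ^ k))\<^sup>2 \<le> gsum (Suc k) w * gsum (Suc k) w" by simp
  then have "(real (Suc k))\<^sup>2 * (sqrt (w ^ k))\<^sup>2 \<le> (gsum (Suc k) w)\<^sup>2"
    by (simp only: power_mult_distrib[symmetric] power2_eq_square[of "gsum (Suc k) w"])
  moreover have "(sqrt (w ^ k))\<^sup>2 = w ^ k" using assms by simp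
  ultimately show ?thesis by simp
qed

text \<open>For w > 0 the sums themselves are log-concave in k; it is the division by k that
  reverses the inequality below.\<close>

lemma gsum_log: "gsum (Suc (Suc k)) w * gsum k w = (gsum (Suc k) w)\<^sup>2 - w ^ k"
proof -
  have "w ^ k * (gsum k w * (w - 1)) = w ^ k * (w ^ k - 1)" by (simp only: gsum_geometric)
  then show ?thesis unfolding gsum_Suc power2_eq_square by (simp add: algebra_simps)
qed

definition gmean :: "nat \<Rightarrow> real \<Rightarrow> real" where
  "gmean k w = gsum k w / real k"

text \<open>Since k (k + 2) = (k + 1)^2 - 1, clearing denominators and inserting
  \<open>gsum_log\<close> leaves precisely the difference that \<open>gsum_square_ge\<close> shows
  to be nonnegative.\<close>

lemma gmean_log_convex:
  assumes "0 < w" "0 < k"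
  shows "(gmean (Suc k) w)\<^sup>2 \<le> gmean (Suc (Suc k)) w * gmean k w"
proof -
  have "(real (Suc k))\<^sup>2 * ((gsum (Suc k) w)\<^sup>2 - w ^ k) - (gsum (Suc k) w)\<^sup>2 * (real (Suc (Suc k)) * real k)
      = (gsum (Suc k) w)\<^sup>2 - (real (Suc k))\<^sup>2 * w ^ k"
    by (simp add: algebra_simps power2_eq_square)
  then have "(gsum (Suc k) w)\<^sup>2 * (real (Suc (Suc k)) * real k) \<le> (real (Suc k))\<^sup>2 * (gsum (Suc (Suc k)) w * gsum k w)"
    unfolding gsum_log using gsum_square_ge[OF assms(1), of k] by linarith
  then show ?thesis
    unfolding gmean_def power_divide times_divide_times_eq using assms(2)
    by (subst frac_le_eq) (auto simp: divide_le_0_iff mult.commute)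
qed

definition gratio :: "nat \<Rightarrow> real \<Rightarrow> real" where
  "gratio k w = gmean (Suc k) w / gmean k w"

lemma gmean_pos: "0 < w \<Longrightarrow> 0 < k \<Longrightarrow> 0 < gmean k w"
  by (simp add: gmean_def gsum_pos)

lemma gratio_mono:
  assumes "0 < w" "0 < j" "j \<le> k"
  shows "gratio j w \<le> gratio k w"
  using assms(3)
proof (induction rule: dec_induct)
  case (step k)
  have "gratio k w \<le> gratio (Suc k) w"
    unfolding gratio_def
    using gmean_log_convex[OF assms(1), of k] gmean_pos[OF assms(1)] step assms(2)
    by (simp add: field_simps power2_eq_square)
  then show ?case using step by simp
qed simp

text \<open>The mean telescopes into m consecutive ratios starting from \<open>gmean 1 w\<close> =
  1, and each of them is at most a later one.\<close>

lemma gmean_le_power: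
  assumes "0 < w" "m \<le> k"
  shows "gmean (Suc m) w \<le> gratio (Suc k) w ^ m"
  using assms(2)
proof (induction m)
  case (Suc m)
  have "gmean (Suc (Suc m)) w = gratio (Suc m) w * gmean (Suc m) w"
    using gmean_pos[OF assms(1), of "Suc m"] by (simp add: gratio_def)
  also have "\<dots> \<le> gratio (Suc k) w * gratio (Suc k) w ^ m"
    using Suc gratio_mono[OF assms(1), of "Suc m" "Suc k"] gmean_pos[OF assms(1)]
    by (intro mult_mono) (auto simp: gratio_def intro!: divide_nonneg_nonneg less_imp_le)
  finally show ?case by simp
qed (simp add: gmean_def gsum_def)

text \<open>The activity \<open>pair_act r w\<close> at which the recursion on the \<open>r\<close>-ary tree has a
  fixed point with \<open>(1 + v) / (1 + u) = w\<close>.\<close>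

definition pair_act :: "nat \<Rightarrow> real \<Rightarrow> real" where
  "pair_act r w = (gsum (Suc r) w / gsum r w) ^ r / (w * gsum (r - 1) w)"

text \<open>After division by the value at w = 1 the claim reads w * \<open>gmean (r - 1) w\<close>
  < B^r with B = \<open>gratio r w\<close>. Two factors B exceed w, because B is at least
  \<open>gratio 1 w\<close> = (1 + w) / 2 and the arithmetic mean of 1 and w beats the geometric
  one; the other r - 2 factors dominate the mean.\<close>

lemma pair_act_gt:
  assumes "1 < w" "2 \<le> r"
  shows "pair_act r 1 < pair_act r w"
proof -
  obtain m where r: "r = Suc (Suc m)" using assms(2) by (metis add_2_eq_Suc le_Suc_ex)
  have w: "0 < w" using assms(1) by simp
  let ?B = "gratio r w"
  have B: "?B > 0" unfolding gratio_def using gmean_pos[OF w] r by simp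
  have B1: "(1 + w) / 2 \<le> ?B"
    using gratio_mono[OF w, of 1 r] r by (simp add: gratio_def gmean_def gsum_def)
  have "0 < (w - 1)\<^sup>2" using assms(1) by simp
  then have "w < ((1 + w) / 2)\<^sup>2" by (simp add: power2_eq_square field_simps)
  also have "\<dots> \<le> ?B\<^sup>2" using B1 w by (intro power_mono) auto
  finally have wB: "w < ?B\<^sup>2" .
  have "gratio (Suc m) w \<le> ?B" using gratio_mono[OF w, of "Suc m" r] r by simp
  then have "gratio (Suc m) w ^ m \<le> ?B ^ m"
    using gmean_pos[OF w] by (intro power_mono) (auto simp: gratio_def intro!: divide_nonneg_nonneg less_imp_le)
  then have "gmean (Suc m) w \<le> ?B ^ m" using gmean_le_power[OF w, of m m] by simp
  then have "w * gmean (Suc m) w < ?B\<^sup>2 * ?B ^ m"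
    using wB B gmean_pos[OF w, of "Suc m"] w by (intro mult_less_le_imp_less) auto
  also have "\<dots> = ?B ^ r" by (simp add: r power2_eq_square)
  finally have key: "w * gmean (Suc m) w < ?B ^ r" .
  have "gsum (Suc r) w / gsum r w = real (Suc r) / real r * ?B"
    using r by (simp add: gratio_def gmean_def)
  moreover have "gsum (r - 1) w = real (Suc m) * gmean (Suc m) w" by (simp add: r gmean_def)
  ultimately have "pair_act r w = (real (Suc r) / real r) ^ r / real (Suc m) * (?B ^ r / (w * gmean (Suc m) w))"
    unfolding pair_act_def by (simp only: power_mult_distrib times_divide_times_eq mult.left_commute)
  moreover have "pair_act r 1 = (real (Suc r) / real r) ^ r / real (Suc m)"
    unfolding pair_act_def gsum_one by (simp add: r)
  moreover have "1 < ?B ^ r / (w * gmean (Suc m) w)"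
    using key w gmean_pos[OF w, of "Suc m"] by simp
  moreover have "0 < (real (Suc r) / real r) ^ r / real (Suc m)" using r by simp
  ultimately show ?thesis by (metis mult.right_neutral mult_strict_left_mono)
qed

text \<open>Linear growth, by which the intermediate value theorem in \<open>pair_act_surj\<close>
  reaches every activity above the threshold.\<close>

lemma pair_act_ge:
  assumes "1 \<le> w" "2 \<le> r"
  shows "w / real (r - 1) \<le> pair_act r w"
proof -
  obtain m where r: "r = Suc (Suc m)" using assms(2) by (metis add_2_eq_Suc le_Suc_ex)
  have w: "0 < w" using assms(1) by simp
  have "w \<le> gsum (Suc r) w / gsum r w"
    using gsum_pos[OF w, of r] assms(2) by (simp add: pos_le_divide_eq gsum_Suc')
  then have 1: "w ^ r \<le> (gsum (Suc r) w / gsum r w) ^ r" using w by (intro power_mono) auto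
  have "w / real (r - 1) = w ^ r / (w * (real (Suc m) * w ^ m))"
  proof -
    have "w / M = w * (w * q) / (w * (M * q))" if "0 < q" for M q :: real using w that by simp
    from this[of "w ^ m" "real (Suc m)"] show ?thesis using w by (simp add: r)
  qed
  also have "\<dots> \<le> pair_act r w"
    unfolding pair_act_def
  proof (rule frac_le)
    show "0 \<le> (gsum (Suc r) w / gsum r w) ^ r" using 1 w by (meson order_trans zero_le_power less_imp_le)
    show "0 < w * gsum (r - 1) w" using w gsum_pos[OF w, of "Suc m"] by (simp add: r)
    show "w * gsum (r - 1) w \<le> w * (real (Suc m) * w ^ m)"
      using w gsum_upper[OF assms(1), of m] by (intro mult_left_mono) (simp_all add: r)
  qed (rule 1)
  finally show ?thesis .
qed

lemma pair_act_surj: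
  assumes "pair_act r 1 < L" "2 \<le> r"
  obtains w where "1 < w" "pair_act r w = L"
proof -
  define W where "W = max 1 (L * real (r - 1))"
  have "\<exists>w\<ge>1. w \<le> W \<and> pair_act r w = L"
  proof (rule IVT')
    have "L \<le> W / real (r - 1)" using assms(2) by (simp add: W_def field_simps)
    also have "\<dots> \<le> pair_act r W" using assms(2) by (intro pair_act_ge) (simp_all add: W_def)
    finally show "L \<le> pair_act r W" .
    show "continuous_on {1..W} (pair_act r)"
    proof -
      have cont: "continuous_on {1..W} (gsum k)" for k
        unfolding gsum_def by (intro continuous_intros)
      have nz: "gsum k x \<noteq> 0" if "x \<in> {1..W}" "0 < k" for x k
        using gsum_pos[of x k] that by simp
      show ?thesis unfolding pair_act_def
        by (intro continuous_intros cont ballI) (use nz assms(2) in auto)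
    qed
  qed (use assms in \<open>auto simp: W_def\<close>)
  then obtain w where "1 \<le> w" "pair_act r w = L" by blast
  moreover from this have "w \<noteq> 1" using assms(1) by auto
  ultimately show ?thesis using that[of w] by simp
qed

section \<open>Asymmetric fixed points of the recursion\<close>

definition tree_step :: "nat \<Rightarrow> real \<Rightarrow> real \<Rightarrow> real \<Rightarrow> real" where
  "tree_step r L u v = L * ((1 + u) / (1 + u + v)) ^ r"

text \<open>At a fixed point this forces v = w^r u, so the two fixed-point equations reduce to one
  of them together with this relation.\<close>

lemma tree_step_swap:
  assumes "1 + v = w * (1 + u)"
  shows "tree_step r L v u = w ^ r * tree_step r L u v"
proof -
  have "1 + v + u = 1 + u + v" by simp
  then have "(1 + v) / (1 + v + u) = w * ((1 + u) / (1 + u + v))" by (simp add: assms)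
  then show ?thesis by (simp only: tree_step_def power_mult_distrib mult.left_commute)
qed

lemma fixed_pair_exists:
  assumes "pair_act r 1 < L" "2 \<le> r"
  obtains u v where "0 < u" "u < v" "u = tree_step r L u v" "v = tree_step r L v u"
proof -
  obtain w where w: "1 < w" and L: "pair_act r w = L" using pair_act_surj[OF assms] .
  obtain m where r: "r = Suc (Suc m)" using assms(2) by (metis add_2_eq_Suc le_Suc_ex)
  \<comment> \<open>Inserting v = w^r u into 1 + v = w (1 + u) gives u w (w^(r-1) - 1) = w - 1;
    dividing by w - 1 leaves u w \<open>gsum (r - 1) w\<close> = 1, where r - 1 is
    \<open>Suc m\<close>.\<close>
  define u where "u = 1 / (w * gsum (Suc m) w)"
  define v where "v = u * w ^ r"
  have S: "0 < gsum k w" if "0 < k" for k using gsum_pos w that by simp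
  have u: "0 < u" unfolding u_def using S[of "Suc m"] w by simp
  have 1: "1 + u = gsum r w / (w * gsum (Suc m) w)"
    unfolding u_def r gsum_Suc'[of "Suc m"] using S[of "Suc m"] w by (simp add: field_simps)
  have 2: "1 + v = w * (1 + u)"
  proof -
    have "u * (w * (gsum (Suc m) w * (w - 1))) = w - 1" unfolding u_def using S[of "Suc m"] w by simp
    then show ?thesis unfolding v_def gsum_geometric by (simp add: r algebra_simps)
  qed
  have 3: "(1 + u + v) / (1 + u) = gsum (Suc r) w / gsum r w"
  proof -
    have "u / (1 + u) = 1 / gsum r w" unfolding 1 unfolding u_def using S[of "Suc m"] w by simp
    moreover have "(1 + u + v) / (1 + u) = w + u / (1 + u)" using 2 u by (simp add: field_simps)
    ultimately have "(1 + u + v) / (1 + u) = w + 1 / gsum r w" by simp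
    also have "\<dots> = (1 + w * gsum r w) / gsum r w"
      using S[of r] assms by (simp add: add_divide_distrib)
    finally show ?thesis by (simp only: gsum_Suc')
  qed
  have 4: "L = u * ((1 + u + v) / (1 + u)) ^ r"
  proof -
    have "r - 1 = Suc m" by (simp add: r)
    then have "pair_act r w = u * (gsum (Suc r) w / gsum r w) ^ r" unfolding pair_act_def u_def by simp
    then show ?thesis by (simp only: 3 L)
  qed
  have v: "u < v" unfolding v_def using u one_less_power[OF w, of r] r by simp
  then have nz: "0 < 1 + u + v" "0 < 1 + u" using u by auto
  have "u = tree_step r L u v"
    unfolding tree_step_def 4 using nz by (simp add: power_divide)
  moreover from this have "v = tree_step r L v u"
    unfolding tree_step_swap[OF 2] by (simp add: v_def mult.commute)
  ultimately show ?thesis using that u v by blast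
qed

text \<open>The derivation of the pair from w can be read backwards: an asymmetric fixed point
  determines w > 1, then u, and finally L as \<open>pair_act r w\<close>, which lies strictly above
  the value at 1.\<close>

lemma fixed_pair_imp_gt:
  assumes "0 < u" "u < v" "u = tree_step r L u v" "v = tree_step r L v u" "2 \<le> r"
  shows "pair_act r 1 < L"
proof -
  define w where "w = (1 + v) / (1 + u)"
  obtain m where r: "r = Suc (Suc m)" using assms(5) by (metis add_2_eq_Suc le_Suc_ex)
  have w: "1 < w" unfolding w_def using assms by simp
  have S: "0 < gsum k w" if "0 < k" for k using gsum_pos w that by simp
  have 2: "1 + v = w * (1 + u)" using assms by (simp add: w_def)
  have nz: "0 < 1 + u + v" "0 < 1 + u" using assms by auto
  have v: "v = u * w ^ r"
  proof -
    have "v = w ^ r * tree_step r L u v" using assms(4) unfolding tree_step_swap[OF 2] .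
    then show ?thesis using assms(3) by (simp add: mult.commute)
  qed
  have uS: "u * (w * gsum (Suc m) w) = 1"
  proof -
    have "u * (w * (gsum (Suc m) w * (w - 1))) = w - 1"
      unfolding gsum_geometric using 2 unfolding v by (simp add: r algebra_simps)
    then have "(u * (w * gsum (Suc m) w) - 1) * (w - 1) = 0" by (simp add: algebra_simps)
    then show ?thesis using w by simp
  qed
  have u: "u = 1 / (w * gsum (Suc m) w)" using uS S[of "Suc m"] w by (simp add: field_simps)
  have 1: "1 + u = gsum r w / (w * gsum (Suc m) w)"
    unfolding u r gsum_Suc'[of "Suc m"] using S[of "Suc m"] w by (simp add: field_simps)
  have 3: "(1 + u + v) / (1 + u) = gsum (Suc r) w / gsum r w"
  proof -
    have "u / (1 + u) = 1 / gsum r w" unfolding 1 unfolding u using S[of "Suc m"] w by simp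
    moreover have "(1 + u + v) / (1 + u) = w + u / (1 + u)" using 2 nz by (simp add: field_simps)
    ultimately have "(1 + u + v) / (1 + u) = w + 1 / gsum r w" by simp
    also have "\<dots> = (1 + w * gsum r w) / gsum r w"
      using S[of r] assms by (simp add: add_divide_distrib)
    finally show ?thesis by (simp only: gsum_Suc')
  qed
  have "u * ((1 + u + v) / (1 + u)) ^ r = L"
  proof -
    have "u * ((1 + u + v) / (1 + u)) ^ r = tree_step r L u v * ((1 + u + v) / (1 + u)) ^ r" using assms(3) by simp
    also have "\<dots> = L" unfolding tree_step_def using nz by (simp add: power_divide)
    finally show ?thesis .
  qed
  moreover have "pair_act r w = u * (gsum (Suc r) w / gsum r w) ^ r"
  proof -
    have "r - 1 = Suc m" by (simp add: r)
    then show ?thesis unfolding pair_act_def by (subst u) simp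
  qed
  ultimately have "L = pair_act r w" by (simp only: 3)
  then show ?thesis using pair_act_gt[OF w assms(5)] by simp
qed

section \<open>Two-sided bounds for the iterated recursion\<close>

lemma tree_step_mono:
  assumes "0 \<le> L" "0 \<le> u" "u \<le> u'" "0 \<le> v'" "v' \<le> v"
  shows "tree_step r L u v \<le> tree_step r L u' v'"
proof -
  have "(1 + u) * v' \<le> (1 + u') * v" using assms by (intro mult_mono) auto
  then have "(1 + u) * (1 + u' + v') \<le> (1 + u') * (1 + u + v)" by (simp add: algebra_simps)
  then have "(1 + u) / (1 + u + v) \<le> (1 + u') / (1 + u' + v')"
    using assms by (subst frac_le_eq) (auto simp: divide_le_0_iff)
  then show ?thesis unfolding tree_step_def using assms by (intro mult_left_mono power_mono) auto
qed

lemma tree_step_pos: "0 < L \<Longrightarrow> 0 \<le> u \<Longrightarrow> 0 \<le> v \<Longrightarrow> 0 < tree_step r L u v"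
  by (simp add: tree_step_def)

text \<open>Upper and lower bounds, common to both color ratios, after j generations. A ratio
  increases in its own color and decreases in the other one, so the two bounds must be iterated
  together. The start is the bare activity l and not L, because next to the boundary the pendants
  may be frozen too.\<close>

primrec envelope :: "nat \<Rightarrow> real \<Rightarrow> real \<Rightarrow> nat \<Rightarrow> real \<times> real" where
  "envelope r L l 0 = (l, 0)"
| "envelope r L l (Suc j) = (tree_step r L (fst (envelope r L l j)) (snd (envelope r L l j)),
    tree_step r L (snd (envelope r L l j)) (fst (envelope r L l j)))"

lemma envelope_mono:
  assumes "0 < L" "L \<le> l"
  shows "0 \<le> snd (envelope r L l j) \<and> snd (envelope r L l j) \<le> fst (envelope r L l j)
    \<and> fst (envelope r L l (Suc j)) \<le> fst (envelope r L l j) \<and> snd (envelope r L l j) \<le> snd (envelope r L l (Suc j))"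
proof (induction j)
  case 0
  show ?case using assms by (simp add: tree_step_def)
next
  case (Suc j)
  let ?h = "fst (envelope r L l j)" and ?o = "snd (envelope r L l j)"
  let ?h' = "fst (envelope r L l (Suc j))" and ?o' = "snd (envelope r L l (Suc j))"
  have o: "0 \<le> ?o" "?o \<le> ?h" "?h' \<le> ?h" "?o \<le> ?o'" using Suc by auto
  have "0 \<le> ?o'" using o by linarith
  moreover have le: "?o' \<le> ?h'" unfolding envelope.simps fst_conv snd_conv using assms o by (intro tree_step_mono) auto
  moreover have "tree_step r L ?h' ?o' \<le> tree_step r L ?h ?o" "tree_step r L ?o ?h \<le> tree_step r L ?o' ?h'"
    using assms o le by (intro tree_step_mono; linarith)+
  ultimately show ?case by simp
qed

text \<open>Monotone convergence and continuity give a fixed pair, possibly asymmetric. It serves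
  twice: as a boundary law proving existence at every activity, and, when both limits coincide, as a
  squeeze proving uniqueness.\<close>

lemma envelope_limit:
  assumes "0 < L" "L \<le> l"
  obtains U V where "(\<lambda>j. fst (envelope r L l j)) \<longlonglongrightarrow> U" "(\<lambda>j. snd (envelope r L l j)) \<longlonglongrightarrow> V"
    "0 < V" "V \<le> U" "U = tree_step r L U V" "V = tree_step r L V U"
proof -
  let ?h = "\<lambda>j. fst (envelope r L l j)" and ?o = "\<lambda>j. snd (envelope r L l j)"
  note m = envelope_mono[OF assms, of r]
  have dec: "decseq ?h" using m by (intro decseq_SucI) blast
  have inc: "incseq ?o" using m by (intro incseq_SucI) blast
  have "0 \<le> ?h j" for j using m[of j] by linarith
  then obtain U where U: "?h \<longlonglongrightarrow> U" using decseq_convergent[OF dec, of 0] by blast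
  have "?o j \<le> l" for j
    using m[of j] decseqD[OF dec, of 0 j] by simp
  then obtain V where V: "?o \<longlonglongrightarrow> V" using incseq_convergent[OF inc, of l] by blast
  have VU: "V \<le> U" by (rule LIMSEQ_le[OF V U]) (use m in blast)
  have V0: "0 \<le> V" by (rule LIMSEQ_le_const[OF V]) (use m in blast)
  have lim: "(\<lambda>j. tree_step r L (a j) (b j)) \<longlonglongrightarrow> tree_step r L A B"
    if "a \<longlonglongrightarrow> A" "b \<longlonglongrightarrow> B" "0 \<le> A" "0 \<le> B" for a b A B
    unfolding tree_step_def using that by (intro tendsto_intros) auto
  have "(\<lambda>j. ?h (Suc j)) \<longlonglongrightarrow> tree_step r L U V" using lim[OF U V] VU V0 by simp
  then have U': "U = tree_step r L U V" using LIMSEQ_Suc[OF U] LIMSEQ_unique by blast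
  have "(\<lambda>j. ?o (Suc j)) \<longlonglongrightarrow> tree_step r L V U" using lim[OF V U] VU V0 by simp
  then have V': "V = tree_step r L V U" using LIMSEQ_Suc[OF V] LIMSEQ_unique by blast
  have "0 < tree_step r L V U" using assms VU V0 by (intro tree_step_pos) auto
  then have "0 < V" using V' by simp
  then show ?thesis using that U V VU U' V' by blast
qed

text \<open>A pendant vertex contributes the factor \<open>1 + l\<close> to a green or red neighbour and
  \<open>1 + 2 l\<close> to a yellow one.\<close>

definition eff_act :: "nat \<Rightarrow> real \<Rightarrow> real" where
  "eff_act k l = l * ((1 + l) / (1 + 2 * l)) ^ k"

section \<open>Shape of the effective activity\<close>

lemma eff_act_pos: "0 < l \<Longrightarrow> 0 < eff_act k l"
  by (simp add: eff_act_def)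

lemma eff_act_le: "0 < l \<Longrightarrow> eff_act k l \<le> l"
  unfolding eff_act_def by (simp add: mult_left_le power_le_one)

text \<open>Up to positive factors the derivative is (1 + l) (1 + 2 l) - 8 l = 2 l^2 - 5 l + 1, of
  discriminant 17.\<close>

lemma eff_act_8_deriv:
  assumes "0 \<le> l"
  shows "(eff_act 8 has_real_derivative
    2 * ((1 + l) / (1 + 2 * l)) ^ 7 / (1 + 2 * l)\<^sup>2 * ((l - (5 - sqrt 17) / 4) * (l - (5 + sqrt 17) / 4))) (at l)"
proof -
  have "(l - (5 - sqrt 17) / 4) * (l - (5 + sqrt 17) / 4) = ((4 * l - 5)\<^sup>2 - (sqrt 17)\<^sup>2) / 16"
    by (simp add: power2_eq_square field_simps)
  also have "\<dots> = (2 * l\<^sup>2 - 5 * l + 1) / 2" by (simp add: power2_eq_square field_simps)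
  finally have *: "(l - (5 - sqrt 17) / 4) * (l - (5 + sqrt 17) / 4) = (2 * l\<^sup>2 - 5 * l + 1) / 2" .
  have nz: "1 + 2 * l \<noteq> 0" using assms by simp
  let ?q = "(1 + l) / (1 + 2 * l)"
  have "((\<lambda>l. l * ((1 + l) / (1 + 2 * l)) ^ 8) has_real_derivative
      ?q ^ 8 + l * (8 * ?q ^ 7 * (- 1 / (1 + 2 * l)\<^sup>2))) (at l)"
  proof -
    have "((\<lambda>l. (1 + l) / (1 + 2 * l)) has_real_derivative - 1 / (1 + 2 * l)\<^sup>2) (at l)"
      using nz by (auto intro!: derivative_eq_intros simp: power2_eq_square field_simps)
    from DERIV_mult[OF DERIV_ident DERIV_power[OF this, of 8]] show ?thesis
      by (rule DERIV_cong) simp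
  qed
  moreover have "?q ^ 8 + l * (8 * ?q ^ 7 * (- 1 / (1 + 2 * l)\<^sup>2))
      = 2 * ?q ^ 7 / (1 + 2 * l)\<^sup>2 * ((2 * l\<^sup>2 - 5 * l + 1) / 2)"
  proof -
    have "(8::nat) = Suc 7" by simp
    then have "?q ^ 8 = ?q ^ 7 * ?q" by (simp only: power_Suc2)
    then have "?q ^ 8 + l * (8 * ?q ^ 7 * (- 1 / (1 + 2 * l)\<^sup>2)) = ?q ^ 7 * (?q + l * 8 * (- 1 / (1 + 2 * l)\<^sup>2))"
      by (simp only: distrib_left mult_ac)
    also have "?q + l * 8 * (- 1 / (1 + 2 * l)\<^sup>2) = (2 * l\<^sup>2 - 5 * l + 1) / (1 + 2 * l)\<^sup>2"
    proof -
      have "?q = (1 + l) * (1 + 2 * l) / (1 + 2 * l)\<^sup>2" using nz by (simp add: power2_eq_square)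
      then have "?q + l * 8 * (- 1 / (1 + 2 * l)\<^sup>2) = ((1 + l) * (1 + 2 * l) - 8 * l) / (1 + 2 * l)\<^sup>2"
        by (simp add: diff_divide_distrib)
      also have "(1 + l) * (1 + 2 * l) - 8 * l = 2 * l\<^sup>2 - 5 * l + 1"
        by (simp add: algebra_simps power2_eq_square)
      finally show ?thesis .
    qed
    finally show ?thesis by simp
  qed
  ultimately show ?thesis unfolding * eff_act_def[abs_def] by simp
qed

lemma continuous_eff_act: "0 \<le> a \<Longrightarrow> continuous_on {a..b} (eff_act k)"
  unfolding eff_act_def by (intro continuous_intros) auto

lemma eff_act_8_superlevel:
  assumes "2 * (3 / 5) ^ 8 < t" "t < (1 / 4) * (5 / 6) ^ 8"
  obtains a b c where "0 < a" "a < b" "b < c"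
    "\<And>l. 0 < l \<Longrightarrow> eff_act 8 l \<le> t \<longleftrightarrow> l \<le> a \<or> b \<le> l \<and> l \<le> c"
proof -
  define x y where "x = (5 - sqrt 17) / 4" and "y = (5 + sqrt 17) / 4"
  have s: "4 < sqrt 17" "sqrt 17 < 5" by (auto intro: real_less_rsqrt real_less_lsqrt)
  have xy: "0 < x" "x < 1/4" "2 < y" "y < 3" using s by (auto simp: x_def y_def)
  have deriv: "\<exists>d. DERIV (eff_act 8) l :> d \<and> (0 < (l - x) * (l - y) \<longrightarrow> 0 < d) \<and> ((l - x) * (l - y) < 0 \<longrightarrow> d < 0)"
    if "0 \<le> l" for l
  proof -
    have c: "0 < 2 * ((1 + l) / (1 + 2 * l)) ^ 7 / (1 + 2 * l)\<^sup>2" using that by simp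
    have "0 < c * e" if "0 < c" "0 < e" for c e :: real using that by simp
    moreover have "c * e < 0" if "0 < c" "e < 0" for c e :: real using that by (simp add: mult_pos_neg)
    ultimately show ?thesis
      using eff_act_8_deriv[OF that, folded x_def y_def] c by blast
  qed
  have inc: "eff_act 8 l < eff_act 8 m" if "0 \<le> l" "l < m" "m \<le> x \<or> y \<le> l" for l m
  proof (rule DERIV_pos_imp_increasing_open[OF that(2)])
    fix z assume z: "l < z" "z < m"
    then have "0 < (z - x) * (z - y)" using that xy by (auto simp: zero_less_mult_iff)
    then show "\<exists>d. DERIV (eff_act 8) z :> d \<and> d > 0" using deriv[of z] z that by auto
  qed (rule continuous_eff_act[OF that(1)])
  have dec: "eff_act 8 m < eff_act 8 l" if "x \<le> l" "l < m" "m \<le> y" for l m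
  proof (rule DERIV_neg_imp_decreasing_open[OF that(2)])
    fix z assume z: "l < z" "z < m"
    then have "(z - x) * (z - y) < 0" using that xy by (auto simp: mult_less_0_iff)
    then show "\<exists>d. DERIV (eff_act 8) z :> d \<and> d < 0" using deriv[of z] z that xy by auto
  qed (rule continuous_eff_act, use that xy in linarith)
  \<comment> \<open>The points 1/4 and 2 lie strictly between the turning points, where the function
    decreases. Their rational values therefore separate t strictly from the local maximum and the
    local minimum.\<close>
  have e14: "eff_act 8 (1/4) = (1 / 4) * (5 / 6) ^ 8" and e2: "eff_act 8 2 = 2 * (3 / 5) ^ 8" and e0: "eff_act 8 0 = 0"
    by (simp_all add: eff_act_def)
  have t0: "0 < t" using assms(1) by (rule less_trans[rotated]) simp
  have ex: "t < eff_act 8 x" using dec[of x "1/4"] xy assms(2) e14 by simp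
  have ey: "eff_act 8 y < t" using dec[of 2 y] xy assms(1) e2 by simp
  \<comment> \<open>As (1 + l) / (1 + 2 l) exceeds 1/2, the choice l = 2^8 makes the effective
    activity at least 1.\<close>
  have "t \<le> eff_act 8 256"
  proof -
    have "1 \<le> eff_act 8 256" by (simp add: eff_act_def power_divide)
    moreover have "(1 / 4) * (5 / 6) ^ 8 \<le> (1::real)" by (simp add: power_divide)
    ultimately show ?thesis using assms(2) by linarith
  qed
  then obtain c where c: "y \<le> c" "eff_act 8 c = t"
    using IVT'[of "eff_act 8" y t 256] ey xy continuous_eff_act[of y] by auto
  obtain a where a: "0 \<le> a" "a \<le> x" "eff_act 8 a = t"
    using IVT'[of "eff_act 8" 0 t x] ex xy t0 e0 continuous_eff_act[of 0] by auto
  obtain b where b: "x \<le> b" "b \<le> y" "eff_act 8 b = t"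
    using IVT2'[of "eff_act 8" y t x] ex ey xy continuous_eff_act[of x] by auto
  have strict: "0 < a" "a < x" "x < b" "b < y" "y < c"
    using a b c ex ey t0 e0 by (auto simp: order_less_le)
  have "eff_act 8 l \<le> t \<longleftrightarrow> l \<le> a \<or> b \<le> l \<and> l \<le> c" if "0 < l" for l
  proof -
    consider "l < a" | "l = a" | "a < l" "l \<le> x" | "x < l" "l < b" | "l = b" | "b < l" "l \<le> y"
      | "y < l" "l < c" | "l = c" | "c < l" by linarith
    then show ?thesis
    proof cases
      case 1 then show ?thesis using inc[of l a] strict a that by auto
    next
      case 2 then show ?thesis using a by auto
    next
      case 3 then show ?thesis using inc[of a l] strict a that by auto
    next
      case 4 then show ?thesis using dec[of l b] strict b that by auto
    next
      case 5 then show ?thesis using b strict by auto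
    next
      case 6 then show ?thesis using dec[of b l] strict b that by auto
    next
      case 7 then show ?thesis using inc[of l c] strict xy c that by auto
    next
      case 8 then show ?thesis using c strict by auto
    next
      case 9 then show ?thesis using inc[of c l] strict xy c that by auto
    qed
  qed
  moreover have "a < b" "b < c" using strict by linarith+
  ultimately show ?thesis using that[of a b c] strict(1) by blast
qed

text \<open>The threshold (61/60)^60 / 59 is about 0.046, the two bounds are about 0.034 and
  0.058.\<close>

lemma pair_act_60_bounds: "2 * (3 / 5) ^ 8 < pair_act 60 1" "pair_act 60 1 < (1 / 4) * (5 / 6) ^ 8"
  by (simp_all add: pair_act_def gsum_one power_divide)

section \<open>The decorated tree\<close>

text \<open>Pendant vertices are ordinary tree vertices without children, so the theory of
  \<open>tree_model\<close> applies to the decorated board directly; the effective activity emerges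
  only when the recursion is evaluated.\<close>

locale decorated_tree = tree_model p "wr l" for p l +
  fixes inner :: "nat \<Rightarrow> bool" and r k :: nat
  assumes root_inner: "inner 0"
    and pendant: "\<not> inner w \<Longrightarrow> {n. 0 < n \<and> p n = w} = {}"
    and card_inner: "inner w \<Longrightarrow> card {n. 0 < n \<and> p n = w \<and> inner n} = r"
    and card_pendant: "inner w \<Longrightarrow> card {n. 0 < n \<and> p n = w \<and> \<not> inner n} = k"
    and arity: "2 \<le> r"
    and l_pos: "0 < l"
begin

lemma prod_ch:
  fixes h :: "nat \<Rightarrow> real"
  shows "(\<Prod>y\<in>ch w. h y) = (\<Prod>y\<in>{y \<in> ch w. inner y}. h y) * (\<Prod>y\<in>{y \<in> ch w. \<not> inner y}. h y)"
proof -
  have "(\<Prod>y\<in>ch w. h y) = (\<Prod>y\<in>{y \<in> ch w. inner y} \<union> {y \<in> ch w. \<not> inner y}. h y)"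
    by (rule prod.cong) auto
  also have "\<dots> = (\<Prod>y\<in>{y \<in> ch w. inner y}. h y) * (\<Prod>y\<in>{y \<in> ch w. \<not> inner y}. h y)"
    by (rule prod.union_disjoint) (auto simp: finite_ch)
  finally show ?thesis .
qed

lemma ch_pendant: "\<not> inner w \<Longrightarrow> ch w = {}"
  using pendant by (simp add: ch_def)

lemma card_ch:
  assumes "inner w"
  shows "card {y \<in> ch w. inner y} = r" "card {y \<in> ch w. \<not> inner y} = k"
  using card_inner[OF assms] card_pendant[OF assms] by (simp_all add: ch_def conj_assoc)

section \<open>Gibbs measures on the decorated tree from fixed pairs\<close>

definition pair_law :: "real \<Rightarrow> real \<Rightarrow> nat \<Rightarrow> color \<Rightarrow> real" where
  "pair_law u v w c = (if inner w then (case c of Green \<Rightarrow> u | Yellow \<Rightarrow> 1 | Red \<Rightarrow> v) else wr l c)"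

lemma gibbs_of_fixed_pair:
  assumes uv: "0 < u" "0 < v" "u = tree_step r (eff_act k l) u v" "v = tree_step r (eff_act k l) v u"
  obtains P where "gibbs edge (wr l) P"
    "\<And>c. measure P (cyl edge {..<1} (\<lambda>_. c)) = pair_law u v 0 c / (1 + u + v)"
proof -
  let ?g = "pair_law u v"
  \<comment> \<open>Scales the yellow entry at inner vertices to 1. The same division turns the
    pendant factors of green and red into the effective activity.\<close>
  define \<kappa> where "\<kappa> w = (if inner w then 1 / ((1 + u + v) ^ r * (1 + 2 * l) ^ k) else 1)" for w
  have pos: "0 < ?g w c" for w c
    using uv l_pos by (cases c) (auto simp: pair_law_def wr_def)
  have \<kappa>: "0 < \<kappa> w" for w using uv l_pos by (simp add: \<kappa>_def)
  have prod: "(\<Prod>y\<in>ch w. nbr_mass (?g y) c)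
      = (case c of Green \<Rightarrow> 1 + u | Yellow \<Rightarrow> 1 + u + v | Red \<Rightarrow> 1 + v) ^ r
        * (case c of Green \<Rightarrow> 1 + l | Yellow \<Rightarrow> 1 + 2 * l | Red \<Rightarrow> 1 + l) ^ k" if "inner w" for w c
  proof -
    have "nbr_mass (?g y) c = (if inner y then (case c of Green \<Rightarrow> 1 + u | Yellow \<Rightarrow> 1 + u + v | Red \<Rightarrow> 1 + v)
        else (case c of Green \<Rightarrow> 1 + l | Yellow \<Rightarrow> 1 + 2 * l | Red \<Rightarrow> 1 + l))" for y
      by (cases c) (auto simp: nbr_mass_simps pair_law_def wr_def)
    then show ?thesis
      unfolding prod_ch using card_ch[OF that] by simp
  qed
  have law: "?g w c = \<kappa> w * wr l c * (\<Prod>y\<in>ch w. nbr_mass (?g y) c)" for w c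
  proof (cases "inner w")
    case False
    then show ?thesis by (simp add: pair_law_def \<kappa>_def ch_pendant)
  next
    case True
    have nz: "(1 + u + v) ^ r \<noteq> 0" "(1 + 2 * l) ^ k \<noteq> 0" using uv l_pos by auto
    have uvc: "1 + v + u = 1 + u + v" by simp
    show ?thesis
    proof (cases c)
      case Green
      have "?g w c = tree_step r (eff_act k l) u v" using True Green uv(3) by (simp add: pair_law_def)
      also have "\<dots> = \<kappa> w * wr l c * (\<Prod>y\<in>ch w. nbr_mass (?g y) c)"
        unfolding prod[OF True] \<kappa>_def using True Green
        by (simp add: tree_step_def eff_act_def wr_def power_divide mult_ac)
      finally show ?thesis .
    next
      case Yellow
      then show ?thesis unfolding prod[OF True] \<kappa>_def using True nz by (simp add: pair_law_def wr_def)
    next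
      case Red
      have "?g w c = tree_step r (eff_act k l) v u" using True Red uv(4) by (simp add: pair_law_def)
      also have "\<dots> = \<kappa> w * wr l c * (\<Prod>y\<in>ch w. nbr_mass (?g y) c)"
        unfolding prod[OF True] \<kappa>_def tree_step_def uvc using True Red
        by (simp add: eff_act_def wr_def power_divide mult_ac)
      finally show ?thesis .
    qed
  qed
  obtain P where "gibbs edge (wr l) P"
    "\<And>c. measure P (cyl edge {..<1} (\<lambda>_. c)) = ?g 0 c / nbr_mass (?g 0) Yellow"
    using boundary_law_gibbs[where g = ?g and \<kappa> = \<kappa>, OF pos \<kappa> law] by blast
  moreover have "nbr_mass (?g 0) Yellow = 1 + u + v"
    using root_inner by (simp add: nbr_mass_simps pair_law_def)
  ultimately show ?thesis using that by simp
qed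

text \<open>Exchanging green and red turns the fixed pair (u, v) into (v, u). The two resulting
  measures differ in the probability of a green root.\<close>

lemma gibbs_nonunique:
  assumes "pair_act r 1 < eff_act k l"
  shows "\<exists>P Q. gibbs edge (wr l) P \<and> gibbs edge (wr l) Q \<and> P \<noteq> Q"
proof -
  obtain u v where uv: "0 < u" "u < v" "u = tree_step r (eff_act k l) u v" "v = tree_step r (eff_act k l) v u"
    using fixed_pair_exists[OF assms arity] .
  then have "0 < v" by simp
  obtain P where P: "gibbs edge (wr l) P"
    "\<And>c. measure P (cyl edge {..<1} (\<lambda>_. c)) = pair_law u v 0 c / (1 + u + v)"
    using gibbs_of_fixed_pair[OF uv(1) \<open>0 < v\<close> uv(3,4)] by blast
  obtain Q where Q: "gibbs edge (wr l) Q"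
    "\<And>c. measure Q (cyl edge {..<1} (\<lambda>_. c)) = pair_law v u 0 c / (1 + v + u)"
    using gibbs_of_fixed_pair[OF \<open>0 < v\<close> uv(1) uv(4,3)] by blast
  have "u / (1 + u + v) \<noteq> v / (1 + v + u)" using uv by (simp add: field_simps)
  then have "P \<noteq> Q" using P(2)[of Green] Q(2)[of Green] root_inner by (auto simp: pair_law_def)
  then show ?thesis using P(1) Q(1) by blast
qed

text \<open>The envelope supplies a fixed pair at every activity, which stands in for a compactness
  argument.\<close>

lemma gibbs_exists: "\<exists>P. gibbs edge (wr l) P"
proof -
  obtain U V where "0 < V" "V \<le> U" "U = tree_step r (eff_act k l) U V" "V = tree_step r (eff_act k l) V U"
    using envelope_limit[OF eff_act_pos[OF l_pos] eff_act_le[OF l_pos]] by metis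
  then show ?thesis using gibbs_of_fixed_pair[of U V] by (metis order_less_le_trans)
qed

section \<open>Squeezing the ratios under arbitrary boundary conditions\<close>

primrec deep :: "nat \<Rightarrow> nat \<Rightarrow> nat \<Rightarrow> bool" where
  "deep N 0 w \<longleftrightarrow> w < N"
| "deep N (Suc j) w \<longleftrightarrow> w < N \<and> (\<forall>y\<in>ch w. deep N j y)"

text \<open>By local finiteness w and its descendants down to generation j are finitely many, so a
  large enough segment contains them all and j rounds of the recursion run undisturbed.\<close>

lemma eventually_deep: "\<forall>\<^sub>F N in sequentially. deep N j w"
proof (induction j arbitrary: w)
  case 0
  then show ?case by (simp add: eventually_gt_at_top)
next
  case (Suc j)
  then have "\<forall>\<^sub>F N in sequentially. \<forall>y\<in>ch w. deep N j y"
    by (intro eventually_ball_finite finite_ch) auto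
  then show ?case using eventually_gt_at_top[of w] by eventually_elim simp
qed

lemma deep_less: "deep N j w \<Longrightarrow> w < N"
  by (cases j) auto

lemma msg_pendant: "\<not> inner y \<Longrightarrow> y < N \<Longrightarrow> msg N \<psi> y = wr l"
  by (rule HOL.ext) (simp add: msg_rec ch_pendant)

lemma msg_ratio:
  assumes "w < N"
  shows "msg N \<psi> w c / msg N \<psi> w Yellow
    = wr l c * (\<Prod>y\<in>ch w. nbr_mass (msg N \<psi> y) c / nbr_mass (msg N \<psi> y) Yellow)"
  using assms by (simp add: msg_rec wr_def prod_dividef)

lemma nbr_mass_ratio_bounds:
  "0 \<le> nbr_mass (msg N \<psi> y) c / nbr_mass (msg N \<psi> y) Yellow"
  "nbr_mass (msg N \<psi> y) c / nbr_mass (msg N \<psi> y) Yellow \<le> 1"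
  using msg_nonneg[of N \<psi> y] nbr_mass_msg_pos[of N \<psi> y]
  by (cases c; simp add: nbr_mass_simps divide_nonneg_pos)+

text \<open>Each generation between w and the boundary contributes one \<open>tree_step\<close>.
  Green and red are treated in one induction, since the upper bound of either needs the lower bound
  of the other.\<close>

lemma msg_ratio_bounds:
  assumes "deep N j w" "inner w" "c \<noteq> Yellow"
  shows "snd (envelope r (eff_act k l) l j) \<le> msg N \<psi> w c / msg N \<psi> w Yellow
    \<and> msg N \<psi> w c / msg N \<psi> w Yellow \<le> fst (envelope r (eff_act k l) l j)"
  using assms
proof (induction j arbitrary: w c)
  case 0
  have "(\<Prod>y\<in>ch w. nbr_mass (msg N \<psi> y) c / nbr_mass (msg N \<psi> y) Yellow) \<in> {0..1}"
    by (auto intro!: prod_nonneg prod_le_1 nbr_mass_ratio_bounds)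
  then have "wr l c * (\<Prod>y\<in>ch w. nbr_mass (msg N \<psi> y) c / nbr_mass (msg N \<psi> y) Yellow) \<in> {0..l}"
    using l_pos 0(3) by (cases c) (auto simp: wr_def mult_left_le)
  then show ?case using 0(1) by (subst (1 2) msg_ratio) auto
next
  case (Suc j)
  let ?h = "fst (envelope r (eff_act k l) l j)" and ?o = "snd (envelope r (eff_act k l) l j)"
  let ?q = "\<lambda>y. nbr_mass (msg N \<psi> y) c / nbr_mass (msg N \<psi> y) Yellow"
  have env: "0 \<le> ?o" "?o \<le> ?h"
    using envelope_mono[OF eff_act_pos[OF l_pos] eff_act_le[OF l_pos], of r k j] by auto
  have bd: "(1 + ?o) / (1 + ?o + ?h) \<le> ?q y \<and> ?q y \<le> (1 + ?h) / (1 + ?h + ?o)"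
    if "y \<in> {y \<in> ch w. inner y}" for y
  proof -
    let ?m = "msg N \<psi> y"
    have y: "deep N j y" "inner y" using that Suc.prems by auto
    define u v where "u = ?m Green / ?m Yellow" and "v = ?m Red / ?m Yellow"
    have mY: "0 < ?m Yellow" using msg_pos deep_less[OF y(1)] by blast
    have uv: "?o \<le> u" "u \<le> ?h" "?o \<le> v" "v \<le> ?h"
      using Suc.IH[OF y, of Green] Suc.IH[OF y, of Red] by (auto simp: u_def v_def)
    have "?m Green = u * ?m Yellow" "?m Red = v * ?m Yellow" using mY by (simp_all add: u_def v_def)
    then have "nbr_mass ?m Green = (1 + u) * ?m Yellow" "nbr_mass ?m Red = (1 + v) * ?m Yellow"
      "nbr_mass ?m Yellow = (1 + u + v) * ?m Yellow"
      by (simp_all add: nbr_mass_simps algebra_simps)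
    then have "?q y = (if c = Green then (1 + u) / (1 + u + v) else (1 + v) / (1 + v + u))"
      using Suc.prems(3) mY by (cases c) (auto simp: add_ac)
    \<comment> \<open>With one child and activity 1, \<open>tree_step\<close> is the bare quotient,
      so its monotonicity can be reused.\<close>
    moreover have "(1 + a) / (1 + a + b) \<le> (1 + a') / (1 + a' + b')"
      if "?o \<le> a" "a \<le> a'" "?o \<le> b'" "b' \<le> b" for a a' b b'
      using tree_step_mono[of 1 a a' b' b 1] that env by (simp add: tree_step_def)
    ultimately show ?thesis using uv env by simp
  qed
  have "(\<Prod>y\<in>{y \<in> ch w. inner y}. ?q y) \<le> (\<Prod>y\<in>{y \<in> ch w. inner y}. (1 + ?h) / (1 + ?h + ?o))"
    using bd by (intro prod_mono) (auto intro: nbr_mass_ratio_bounds)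
  moreover have "(\<Prod>y\<in>{y \<in> ch w. inner y}. (1 + ?o) / (1 + ?o + ?h)) \<le> (\<Prod>y\<in>{y \<in> ch w. inner y}. ?q y)"
    using bd env by (intro prod_mono) auto
  ultimately have pr: "((1 + ?o) / (1 + ?o + ?h)) ^ r \<le> (\<Prod>y\<in>{y \<in> ch w. inner y}. ?q y)"
    "(\<Prod>y\<in>{y \<in> ch w. inner y}. ?q y) \<le> ((1 + ?h) / (1 + ?h + ?o)) ^ r"
    using card_ch[OF Suc.prems(2)] by simp_all
  have "(\<Prod>y\<in>{y \<in> ch w. \<not> inner y}. ?q y) = (\<Prod>y\<in>{y \<in> ch w. \<not> inner y}. (1 + l) / (1 + 2 * l))"
  proof (rule prod.cong[OF refl])
    fix y assume "y \<in> {y \<in> ch w. \<not> inner y}"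
    then have "msg N \<psi> y = wr l" using Suc.prems(1) deep_less by (auto intro!: msg_pendant)
    then show "?q y = (1 + l) / (1 + 2 * l)"
      using Suc.prems(3) by (cases c) (auto simp: nbr_mass_simps wr_def add_ac)
  qed
  then have "(\<Prod>y\<in>{y \<in> ch w. \<not> inner y}. ?q y) = ((1 + l) / (1 + 2 * l)) ^ k"
    using card_ch[OF Suc.prems(2)] by simp
  moreover have "wr l c = l" using Suc.prems(3) by (cases c) (auto simp: wr_def)
  ultimately have "msg N \<psi> w c / msg N \<psi> w Yellow = eff_act k l * (\<Prod>y\<in>{y \<in> ch w. inner y}. ?q y)"
    using Suc.prems(1) by (subst msg_ratio) (auto simp: prod_ch[of _ w] eff_act_def)
  then show ?case
    using pr eff_act_pos[OF l_pos, of k] by (simp add: tree_step_def mult_left_mono less_imp_le)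
qed

text \<open>If the limits of the envelope differed, they would form an asymmetric fixed point and
  push the activity strictly above the threshold. So they agree, every boundary condition yields the
  same limiting ratios, and \<open>gibbs_unique\<close> applies.\<close>

lemma gibbs_unique_below:
  assumes le: "eff_act k l \<le> pair_act r 1" and PQ: "gibbs edge (wr l) P" "gibbs edge (wr l) Q"
  shows "P = Q"
proof -
  obtain U V where U: "(\<lambda>j. fst (envelope r (eff_act k l) l j)) \<longlonglongrightarrow> U" and V: "(\<lambda>j. snd (envelope r (eff_act k l) l j)) \<longlonglongrightarrow> V"
    and UV: "0 < V" "V \<le> U" "U = tree_step r (eff_act k l) U V" "V = tree_step r (eff_act k l) V U"
    using envelope_limit[OF eff_act_pos[OF l_pos] eff_act_le[OF l_pos]] by metis
  have "U = V"
    using fixed_pair_imp_gt[of V U r "eff_act k l"] UV le arity by (cases "V < U") auto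
  have ratio: "(\<lambda>N. msg N \<psi> w c / msg N \<psi> w Yellow) \<longlonglongrightarrow> V" if "inner w" "c \<noteq> Yellow" for \<psi> w c
  proof (rule order_tendstoI)
    fix a assume "a < V"
    then obtain j where "a < snd (envelope r (eff_act k l) l j)"
      using order_tendstoD(1)[OF V] eventually_happens'[OF sequentially_bot] by blast
    then show "\<forall>\<^sub>F N in sequentially. a < msg N \<psi> w c / msg N \<psi> w Yellow"
      using eventually_deep[of j w] msg_ratio_bounds[of _ j w c \<psi>] that
      by (auto elim!: eventually_mono intro: less_le_trans)
  next
    fix a assume "V < a"
    then obtain j where "fst (envelope r (eff_act k l) l j) < a"
      using order_tendstoD(2)[OF U] \<open>U = V\<close> eventually_happens'[OF sequentially_bot] by blast
    then show "\<forall>\<^sub>F N in sequentially. msg N \<psi> w c / msg N \<psi> w Yellow < a"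
      using eventually_deep[of j w] msg_ratio_bounds[of _ j w c \<psi>] that
      by (auto elim!: eventually_mono intro: le_less_trans)
  qed
  define q where "q w c = (if c = Yellow then 1 else if inner w then (1 + V) / (1 + V + V) else (1 + l) / (1 + 2 * l))"
    for w :: nat and c
  have "(\<lambda>N. nbr_mass (msg N \<psi> w) c / nbr_mass (msg N \<psi> w) Yellow) \<longlonglongrightarrow> q w c" for \<psi> w c
  proof (cases "c = Yellow \<or> \<not> inner w")
    case True
    have "\<forall>\<^sub>F N in sequentially. q w c = nbr_mass (msg N \<psi> w) c / nbr_mass (msg N \<psi> w) Yellow"
      using eventually_gt_at_top[of w]
    proof eventually_elim
      case (elim N)
      show ?case
      proof (cases "c = Yellow")
        case True
        then show ?thesis using nbr_mass_msg_pos[of N \<psi> w] by (simp add: q_def)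
      next
        case False
        then have "\<not> inner w" using \<open>c = Yellow \<or> \<not> inner w\<close> by simp
        then show ?thesis using msg_pendant[of w N \<psi>] elim False
          by (cases c) (auto simp: q_def nbr_mass_simps wr_def add_ac)
      qed
    qed
    then show ?thesis by (rule tendsto_eventually[OF eventually_mono]) auto
  next
    case False
    let ?u = "\<lambda>N. msg N \<psi> w Green / msg N \<psi> w Yellow" and ?v = "\<lambda>N. msg N \<psi> w Red / msg N \<psi> w Yellow"
    have uv: "?u \<longlonglongrightarrow> V" "?v \<longlonglongrightarrow> V" using ratio False by auto
    have ev: "\<forall>\<^sub>F N in sequentially. (if c = Green then (1 + ?u N) / (1 + ?u N + ?v N) else (1 + ?v N) / (1 + ?u N + ?v N))
        = nbr_mass (msg N \<psi> w) c / nbr_mass (msg N \<psi> w) Yellow"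
      using eventually_gt_at_top[of w]
    proof eventually_elim
      case (elim N)
      define y where "y = msg N \<psi> w Yellow"
      have y: "0 < y" using msg_pos[OF elim] by (simp add: y_def)
      have "1 + ?u N = nbr_mass (msg N \<psi> w) Green / y" "1 + ?v N = nbr_mass (msg N \<psi> w) Red / y"
        "1 + ?u N + ?v N = nbr_mass (msg N \<psi> w) Yellow / y"
        using y by (simp_all add: y_def[symmetric] nbr_mass_simps field_simps)
      then show ?case using False y by (cases c) auto
    qed
    have "(\<lambda>N. (1 + ?u N) / (1 + ?u N + ?v N)) \<longlonglongrightarrow> (1 + V) / (1 + V + V)"
      "(\<lambda>N. (1 + ?v N) / (1 + ?u N + ?v N)) \<longlonglongrightarrow> (1 + V) / (1 + V + V)"
      using UV(1) by (intro tendsto_divide tendsto_add tendsto_const uv; simp)+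
    then have "(\<lambda>N. if c = Green then (1 + ?u N) / (1 + ?u N + ?v N) else (1 + ?v N) / (1 + ?u N + ?v N))
        \<longlonglongrightarrow> (if c = Green then (1 + V) / (1 + V + V) else (1 + V) / (1 + V + V))"
      by (cases "c = Green") (simp_all only: simp_thms if_True if_False)
    then show ?thesis
      using Lim_transform_eventually[OF _ ev] False by (auto simp: q_def)
  qed
  then show ?thesis using gibbs_unique[OF PQ] by blast
qed

end

text \<open>With 60 inner children the threshold \<open>pair_act 60 1\<close> lies strictly between the local
  minimum and the local maximum of \<open>eff_act 8\<close>. Inner vertex \<open>i\<close> of the \<open>60\<close>-ary tree is coded as \<open>9 i\<close>, its eight pendant
  neighbours as \<open>9 i + 1, \<dots>, 9 i + 8\<close>.\<close>

definition parent :: "nat \<Rightarrow> nat" where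
  "parent n = (if n mod 9 = 0 then 9 * ((n div 9 - 1) div 60) else 9 * (n div 9))"

lemma children_pendant: "{n. 0 < n \<and> parent n = 9 * i \<and> n mod 9 \<noteq> 0} = {9 * i + 1..<9 * i + 9}"
  unfolding parent_def by (auto split: if_splits) presburger+

lemma children_inner:
  "{n. 0 < n \<and> parent n = 9 * i \<and> n mod 9 = 0} = (\<lambda>j. 9 * j) ` {60 * i + 1..<60 * i + 61}"
proof (intro set_eqI iffI)
  fix n assume n: "n \<in> {n. 0 < n \<and> parent n = 9 * i \<and> n mod 9 = 0}"
  then have "n = 9 * (n div 9)" "n div 9 \<in> {60 * i + 1..<60 * i + 61}"
    by (auto simp: parent_def)
  then show "n \<in> (\<lambda>j. 9 * j) ` {60 * i + 1..<60 * i + 61}" by blast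
qed (auto simp: parent_def)

lemma children_of_pendant: "w mod 9 \<noteq> 0 \<Longrightarrow> {n. 0 < n \<and> parent n = w} = {}"
  by (auto simp: parent_def)

lemma decorated_tree_parent:
  assumes "0 < l"
  shows "decorated_tree parent l (\<lambda>n. n mod 9 = 0) 60 8"
proof
  show "parent n < n" if "0 < n" for n
  proof (cases "n mod 9 = 0")
    case True
    then have "n = 9 * (n div 9)" "0 < n div 9" using that by auto
    moreover have "(n div 9 - 1) div 60 \<le> n div 9 - 1" by (rule div_le_dividend)
    ultimately have "9 * ((n div 9 - 1) div 60) < n" by linarith
    then show ?thesis using True by (simp only: parent_def simp_thms if_True)
  next
    case False
    then have "9 * (n div 9) < n" using mult_div_mod_eq[of 9 n] by linarith
    then show ?thesis using False by (simp only: parent_def if_False)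
  qed
  show "finite {n. 0 < n \<and> parent n = v}" for v
  proof (cases "v mod 9 = 0")
    case True
    then obtain i where v: "v = 9 * i" by auto
    have "{n. 0 < n \<and> parent n = v} = {n. 0 < n \<and> parent n = 9 * i \<and> n mod 9 \<noteq> 0} \<union> {n. 0 < n \<and> parent n = 9 * i \<and> n mod 9 = 0}"
      unfolding v by (intro set_eqI) (simp only: Un_iff mem_Collect_eq, metis)
    then show ?thesis unfolding children_pendant children_inner by simp
  qed (simp add: children_of_pendant)
  show "0 < wr l c" for c using assms by (cases c) (simp_all add: wr_def)
  show "{n. 0 < n \<and> parent n = w} = {}" if "w mod 9 \<noteq> 0" for w by (rule children_of_pendant[OF that])
  fix w :: nat assume "w mod 9 = 0"
  then obtain i where w: "w = 9 * i" by auto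
  show "card {n. 0 < n \<and> parent n = w \<and> n mod 9 = 0} = 60"
    unfolding w children_inner by (subst card_image) (auto intro: inj_onI)
  show "card {n. 0 < n \<and> parent n = w \<and> n mod 9 \<noteq> 0} = 8"
    unfolding w children_pendant by simp
qed (use assms in auto)

theorem theorem7p1:
  shows "\<exists>a b c :: real. 0 < a \<and> a < b \<and> b < c \<and>
    (\<exists>E. board E \<and>
      (\<forall>l. (0 < l \<and> l \<le> a) \<or> (b \<le> l \<and> l \<le> c) \<longrightarrow> (\<exists>!P. gibbs E (wr l) P)) \<and>
      (\<forall>l. (a < l \<and> l < b) \<or> c < l \<longrightarrow>
         (\<exists>P Q. gibbs E (wr l) P \<and> gibbs E (wr l) Q \<and> P \<noteq> Q)))"
proof -
  obtain a b c where abc: "0 < a" "a < b" "b < c"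
    and iff: "\<And>l. 0 < l \<Longrightarrow> eff_act 8 l \<le> pair_act 60 1 \<longleftrightarrow> l \<le> a \<or> b \<le> l \<and> l \<le> c"
    using eff_act_8_superlevel[OF pair_act_60_bounds] by metis
  \<comment> \<open>The edge relation depends on the numbering alone, so one board serves all
    activities although the locale is interpreted anew for each l; for the board property any
    positive activity will do.\<close>
  let ?E = "tree_model.edge parent"
  have "board ?E"
  proof -
    interpret decorated_tree parent 1 "\<lambda>n. n mod 9 = 0" 60 8 by (rule decorated_tree_parent) simp
    show ?thesis by (rule board_edge)
  qed
  moreover have "\<exists>!P. gibbs ?E (wr l) P" if "(0 < l \<and> l \<le> a) \<or> (b \<le> l \<and> l \<le> c)" for l
  proof -
    have l: "0 < l" using that abc by auto
    interpret decorated_tree parent l "\<lambda>n. n mod 9 = 0" 60 8 by (rule decorated_tree_parent[OF l])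
    show ?thesis using gibbs_exists gibbs_unique_below iff[OF l] that by blast
  qed
  moreover have "\<exists>P Q. gibbs ?E (wr l) P \<and> gibbs ?E (wr l) Q \<and> P \<noteq> Q" if "(a < l \<and> l < b) \<or> c < l" for l
  proof -
    have l: "0 < l" using that abc by auto
    interpret decorated_tree parent l "\<lambda>n. n mod 9 = 0" 60 8 by (rule decorated_tree_parent[OF l])
    show ?thesis using gibbs_nonunique iff[OF l] that abc by auto
  qed
  ultimately show ?thesis using abc by blast
qed

end
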